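(* (i) Let $f:[0,1]\to\mathbb{R}$ be a continuous nowhere differentiable function. Then there exists a sequence $(H_j)_{j\in\mathbb{N}}$ of continuous functions on $[0,1]$ such that \[ \underline{h}_f(t)=\liminf_{j\to\infty}H_j(t),\qquad \overline{h}_f(t)=\limsup_{j\to\infty}H_j(t)\qquad\text{for all } t\in[0,1]. \] (ii) Conversely, let $[a,b]\subset(0,1)$ and let $\underline{H},\overline{H}:[0,1]\to[a,b]$ be two functions such that \[ \underline{H}(t)=\liminf_{j\to\infty}H_j(t),\qquad \overline{H}(t)=\limsup_{j\to\infty}H_j(t)\qquad\text{for all } t\in[0,1], \] where $(H_j)_{j\in\mathbb{N}}$ is a sequence of continuous functions on $[0,1]$. Then there exists a uniformly Hölder function $f:[0,1]\to\mathbb{R}$ such that \[ \underline{h}_f(t)=\underline{H}(t)\le\overline{H}(t)=\overline{h}_f(t)\qquad\text{for all } t\in[0,1]. \]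
   Context: Let $f$ be a locally bounded real function on a domain $D$ (here $D=[0,1]$), $x_0\in D$, $\alpha\ge 0$; $[\alpha]$ is the integer part of $\alpha$. Balls $B(x_0,r)$ are understood relative to $D$. Finite differences: $\Delta^1_hf(x)=f(x+h)-f(x)$, $\Delta_h^{n+1}f(x)=\Delta_h^nf(x+h)-\Delta_h^nf(x)$. Put $B_h(x_0,r)=\{x:[x,x+([\alpha]+1)h]\subset B(x_0,r)\}$. $f\in C^\alpha(x_0)$ if there are $C,R>0$ and a polynomial $P$ of degree less than $\alpha$ with $\|f-P\|_{L^\infty(B(x_0,r))}\le Cr^\alpha$ for all $0<r\le R$. $f$ is uniformly Hölder if there are $\varepsilon>0$ and $C>0$ such that for every $x_0\in D$ this holds with $\alpha=\varepsilon$, this $C$ and $R=\infty$ (the polynomial may depend on $x_0$). $f\in I^\alpha(x_0)$ if there are $C,R>0$ with $\sup_{|h|\le r}\|\Delta_h^{[\alpha]+1}f\|_{L^\infty(B_h(x_0,r))}\ge Cr^\alpha$ for all $0<r\le R$. Lower Hölder exponent: $\underline{h}_f(x_0)=\sup\{\alpha: f\in C^\alpha(x_0)\}$. Upper Hölder exponent: $\overline{h}_f(x_0)=\inf\{\alpha:f\in I^\alpha(x_0)\}$. *)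

theory Defs
  imports "HOL-Probability.Essential_Supremum" "HOL-Computational_Algebra.Polynomial"
begin

definition rel_ball :: "real set \<Rightarrow> real \<Rightarrow> real \<Rightarrow> real set" where
  "rel_ball D x0 r = ball x0 r \<inter> D"

(* Being valued in ennreal, esssup is 0 on an empty (or null) set and \<infinity> if g is not
   essentially bounded or not Lebesgue measurable on S. *)
definition Linf_norm :: "real set \<Rightarrow> (real \<Rightarrow> real) \<Rightarrow> ennreal" where
  "Linf_norm S g = esssup (lebesgue_on S) (\<lambda>x. ennreal \<bar>g x\<bar>)"

definition locally_bounded :: "real set \<Rightarrow> (real \<Rightarrow> real) \<Rightarrow> bool" where
  "locally_bounded D f \<longleftrightarrow> (\<forall>x\<in>D. \<exists>r>0. bounded (f ` rel_ball D x r))"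

primrec fin_diff :: "nat \<Rightarrow> real \<Rightarrow> (real \<Rightarrow> real) \<Rightarrow> real \<Rightarrow> real" where
  "fin_diff 0 h f x = f x"
| "fin_diff (Suc n) h f x = fin_diff n h f (x + h) - fin_diff n h f x"

(* h may be negative, hence closed_segment rather than an interval. *)
definition diff_ball :: "real set \<Rightarrow> nat \<Rightarrow> real \<Rightarrow> real \<Rightarrow> real \<Rightarrow> real set" where
  "diff_ball D n h x0 r = {x. closed_segment x (x + real n * h) \<subseteq> rel_ball D x0 r}"

(* The zero polynomial has degree minus infinity; this matters only for \<alpha> = 0, where P = 0. *)
definition degree_less :: "real poly \<Rightarrow> real \<Rightarrow> bool" where
  "degree_less P \<alpha> \<longleftrightarrow> P = 0 \<or> real (degree P) < \<alpha>"

definition hoelder_at :: "real set \<Rightarrow> real \<Rightarrow> (real \<Rightarrow> real) \<Rightarrow> real \<Rightarrow> bool" where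
  "hoelder_at D \<alpha> f x0 \<longleftrightarrow>
     (\<exists>C>0. \<exists>R>0. \<exists>P. degree_less P \<alpha> \<and>
        (\<forall>r. 0 < r \<and> r \<le> R \<longrightarrow>
           Linf_norm (rel_ball D x0 r) (\<lambda>x. f x - poly P x) \<le> ennreal (C * r powr \<alpha>)))"

definition uniformly_hoelder :: "real set \<Rightarrow> (real \<Rightarrow> real) \<Rightarrow> bool" where
  "uniformly_hoelder D f \<longleftrightarrow>
     (\<exists>\<epsilon>>0. \<exists>C>0. \<forall>x0\<in>D. \<exists>P. degree_less P \<epsilon> \<and>
        (\<forall>r>0. Linf_norm (rel_ball D x0 r) (\<lambda>x. f x - poly P x) \<le> ennreal (C * r powr \<epsilon>)))"

definition irregular_at :: "real set \<Rightarrow> real \<Rightarrow> (real \<Rightarrow> real) \<Rightarrow> real \<Rightarrow> bool" where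
  "irregular_at D \<alpha> f x0 \<longleftrightarrow>
     (let n = nat \<lfloor>\<alpha>\<rfloor> + 1 in
      \<exists>C>0. \<exists>R>0. \<forall>r. 0 < r \<and> r \<le> R \<longrightarrow>
        (SUP h\<in>{h. \<bar>h\<bar> \<le> r}. Linf_norm (diff_ball D n h x0 r) (fin_diff n h f))
          \<ge> ennreal (C * r powr \<alpha>))"

(* Extended real values: the upper exponent is \<infinity> when no \<alpha> qualifies. *)
definition lower_hoelder_exponent :: "real set \<Rightarrow> (real \<Rightarrow> real) \<Rightarrow> real \<Rightarrow> ereal" where
  "lower_hoelder_exponent D f x0 = Sup {ereal \<alpha> | \<alpha>. \<alpha> \<ge> 0 \<and> hoelder_at D \<alpha> f x0}"

definition upper_hoelder_exponent :: "real set \<Rightarrow> (real \<Rightarrow> real) \<Rightarrow> real \<Rightarrow> ereal" where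
  "upper_hoelder_exponent D f x0 = Inf {ereal \<alpha> | \<alpha>. \<alpha> \<ge> 0 \<and> irregular_at D \<alpha> f x0}"

end

theory Submission imports Defs begin

text \<open>
  \<^emph>\<open>First part.\<close> Up to a factor 2 in the radius, the oscillation of the \<open>n\<close>-th differences
  near \<open>t\<close> is a supremum over a fixed compact set, hence continuous in \<open>t\<close>; its logarithm at
  the scales \<open>2\<^sup>-\<^sup>j\<close> gives continuous functions \<open>X\<^sub>n\<^sub>,\<^sub>j\<close>. Without
  differentiability at \<open>t\<close> the lower exponent is \<open>liminf\<^sub>j X\<^sub>1\<^sub>,\<^sub>j(t) \<le> 1\<close>. The upper
  exponent involves differences of all orders: it is the infimum of the rational \<open>\<alpha> \<ge> 0\<close> with
  \<open>limsup\<^sub>j X\<^sub>n\<^sub>,\<^sub>j(t) < \<alpha>\<close>, where \<open>n = [\<alpha>] + 1\<close>. So \<open>{t. upper exponent \<ge> \<beta>}\<close> is a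
  countable intersection of open sets for every \<open>\<beta>\<close>, which makes the upper exponent a limit
  superior of continuous functions \<open>B\<^sub>j\<close>. Interleaving \<open>min 1 X\<^sub>1\<^sub>,\<^sub>j\<close> with
  \<open>max (min 1 X\<^sub>1\<^sub>,\<^sub>j) B\<^sub>j\<close> realises both exponents at once.

  \<^emph>\<open>Second part.\<close> Repeat each \<open>H\<^sub>i\<close> over a block of indices far longer than all previous
  ones. The averages \<open>S\<^sub>J(t) / J\<close> of the resulting sequence have the limits inferior and superior
  of the \<open>H\<^sub>i(t)\<close>, the increments of \<open>S\<^sub>J\<close> lie in \<open>[a,b] \<subseteq> (0,1)\<close>, and \<open>S\<^sub>J\<close> varies by only
  \<open>o(J)\<close> over distances \<open>2\<^sup>-\<^sup>J\<close>. The function is a Faber-Schauder series whose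
  coefficients at level \<open>J\<close> are the values of \<open>2 powr - S\<^sub>J\<close> at dyadic points: two geometric sums bound its oscillation at scale \<open>2\<^sup>-\<^sup>J\<close> from above, and
  its second differences, which are the coefficients, bound it from below.
\<close>

subsection \<open>Essential suprema of continuous functions\<close>

lemma Linf_norm_le:
  assumes "S \<in> sets lebesgue" "continuous_on S g" "\<And>x. x \<in> S \<Longrightarrow> \<bar>g x\<bar> \<le> c"
  shows "Linf_norm S g \<le> ennreal c"
  unfolding Linf_norm_def
proof (rule esssup_I)
  have "(\<lambda>x. \<bar>g x\<bar>) \<in> borel_measurable (lebesgue_on S)"
    using assms(1,2) by (intro continuous_imp_measurable_on_sets_lebesgue continuous_intros)
  then show "(\<lambda>x. ennreal \<bar>g x\<bar>) \<in> borel_measurable (lebesgue_on S)"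
    by simp
  show "AE x in lebesgue_on S. ennreal \<bar>g x\<bar> \<le> ennreal c"
    using assms(3) by (auto intro!: AE_I2 ennreal_leI simp: space_restrict_space)
qed

text \<open>A nonempty open set has positive measure, so it cannot be exceptional for an essential
  bound. A small open piece \<open>U\<close> on which continuity controls \<open>g\<close> is
  therefore enough.\<close>

lemma Linf_norm_ge:
  assumes S: "S \<in> sets lebesgue" and U: "open U" "U \<noteq> {}" "U \<subseteq> S"
    and c: "\<And>x. x \<in> U \<Longrightarrow> c \<le> \<bar>g x\<bar>"
  shows "ennreal c \<le> Linf_norm S g"
proof (rule ccontr)
  assume "\<not> ?thesis"
  then have less: "Linf_norm S g < ennreal c"
    by simp
  have "AE x in lebesgue_on S. ennreal \<bar>g x\<bar> \<le> Linf_norm S g"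
    unfolding Linf_norm_def by (rule esssup_AE)
  moreover have "x \<notin> U" if "ennreal \<bar>g x\<bar> \<le> Linf_norm S g" for x
    using that less c[of x] by (meson ennreal_leI leD le_less_trans)
  ultimately have "AE x in lebesgue_on S. x \<notin> U"
    by (auto elim: eventually_mono)
  then have "AE x in lebesgue. x \<in> S \<longrightarrow> x \<notin> U"
    using S by (subst (asm) AE_restrict_space_iff) auto
  then have "AE x in lebesgue. x \<notin> U"
    using U by (auto elim!: eventually_mono)
  moreover have "U \<in> sets lebesgue"
    using U(1) by (simp add: borel_open)
  ultimately have "U \<in> null_sets lebesgue"
    by (subst AE_iff_null_sets)
  then show False
    using U open_not_negligible negligible_iff_null_sets by blast
qed

subsection \<open>Finite differences and their moduli\<close>

text \<open>The nearest-point retraction onto \<open>[0,1]\<close>. Composing with it extends a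
  continuous function from the interval to the line, so that differences make sense everywhere and
  strict inequalities define open subsets of the line.\<close>

definition clamp01 :: "real \<Rightarrow> real" where
  "clamp01 x = max 0 (min 1 x)"

lemma clamp01_mem: "clamp01 x \<in> {0..1}"
  by (auto simp: clamp01_def)

lemma clamp01_id: "x \<in> {0..1} \<Longrightarrow> clamp01 x = x"
  by (auto simp: clamp01_def)

lemma clamp01_nonexpansive: "\<bar>clamp01 x - clamp01 y\<bar> \<le> \<bar>x - y\<bar>"
  by (auto simp: clamp01_def)

lemma continuous_on_clamp01 [continuous_intros]:
  "continuous_on A g \<Longrightarrow> continuous_on A (\<lambda>x. clamp01 (g x))"
  unfolding clamp01_def by (intro continuous_intros)

lemma continuous_on_comp_clamp01:
  assumes "continuous_on {0..1} f"
  shows "continuous_on UNIV (f \<circ> clamp01)"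
  unfolding comp_def
  by (rule continuous_on_compose2[OF assms]) (use clamp01_mem in \<open>auto intro!: continuous_intros\<close>)

lemma fin_diff_cong:
  assumes "\<And>i. i \<le> n \<Longrightarrow> f (x + real i * h) = g (x + real i * h)"
  shows "fin_diff n h f x = fin_diff n h g x"
  using assms
proof (induction n arbitrary: x)
  case 0
  from this[of 0] show ?case by simp
next
  case (Suc n)
  have "f (x + h + real i * h) = g (x + h + real i * h)" if "i \<le> n" for i
    using Suc.prems[of "Suc i"] that by (simp add: algebra_simps)
  moreover have "f (x + real i * h) = g (x + real i * h)" if "i \<le> n" for i
    using Suc.prems[of i] that by simp
  ultimately have "fin_diff n h f (x + h) = fin_diff n h g (x + h)"
    and "fin_diff n h f x = fin_diff n h g x"
    using Suc.IH by blast+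
  then show ?case
    by simp
qed

lemma continuous_on_fin_diff:
  fixes u v :: "'a::topological_space \<Rightarrow> real"
  assumes f: "continuous_on UNIV f" and u: "continuous_on A u" and v: "continuous_on A v"
  shows "continuous_on A (\<lambda>z. fin_diff n (u z) f (v z))"
  using v
proof (induction n arbitrary: v)
  case 0
  then show ?case using continuous_on_compose2[OF f, of A v] by simp
next
  case (Suc n)
  from Suc.prems show ?case
    unfolding fin_diff.simps by (intro continuous_on_diff Suc.IH continuous_on_add u)
qed

text \<open>Differences are parametrised by the two end points instead of base point and step. That
  a chord lies in a ball then becomes one separate condition on each end point, and the admissible
  pairs form a product.\<close>

definition chord_diff :: "nat \<Rightarrow> (real \<Rightarrow> real) \<Rightarrow> real \<Rightarrow> real \<Rightarrow> real" where
  "chord_diff n f a b = fin_diff n ((b - a) / real n) f a"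

lemma chord_point_mem:
  fixes a b :: real
  assumes "i \<le> n" "n \<ge> 1"
  shows "a + real i * ((b - a) / real n) \<in> closed_segment a b"
  unfolding closed_segment_def
  using assms by (intro CollectI exI[of _ "real i / real n"]) (auto simp: field_simps)

lemma fin_diff_cong_segment:
  assumes "\<And>y. y \<in> closed_segment x (x + real n * h) \<Longrightarrow> f y = g y" "n \<ge> 1"
  shows "fin_diff n h f x = fin_diff n h g x"
proof (rule fin_diff_cong)
  fix i assume "i \<le> n"
  have "x + real i * h = x + real i * ((x + real n * h - x) / real n)"
    using assms(2) by simp
  then show "f (x + real i * h) = g (x + real i * h)"
    using chord_point_mem[OF \<open>i \<le> n\<close> assms(2), of x "x + real n * h"] assms(1) by metis
qed

lemma chord_diff_clamp01:
  assumes "a \<in> {0..1}" "b \<in> {0..1}" "n \<ge> 1"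
  shows "chord_diff n (f \<circ> clamp01) a b = chord_diff n f a b"
  unfolding chord_diff_def
proof (rule fin_diff_cong_segment)
  fix y assume "y \<in> closed_segment a (a + real n * ((b - a) / real n))"
  then have "y \<in> closed_segment a b"
    using assms by simp
  then have "y \<in> {0..1}"
    using assms closed_segment_subset[of a "{0..1}" b] by auto
  then show "(f \<circ> clamp01) y = f y"
    by (simp add: clamp01_id)
qed (use assms in auto)

text \<open>Passing through \<open>clamp01\<close> makes the modulus a continuous function of the base point
  on the whole line.\<close>

definition modulus :: "nat \<Rightarrow> (real \<Rightarrow> real) \<Rightarrow> real \<Rightarrow> real \<Rightarrow> real" where
  "modulus n f t r = (SUP p\<in>cbox (-1, -1) (1, 1).
     \<bar>chord_diff n (f \<circ> clamp01) (clamp01 (t + r * fst p)) (clamp01 (t + r * snd p))\<bar>)"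

text \<open>The parameter set \<open>K\<close> does not move with \<open>t\<close>. Uniform
  continuity on the compact set \<open>cball t 1 \<times> K\<close> changes all \<open>g t p\<close>
  by less than \<open>e / 2\<close> simultaneously, and therefore their supremum by at most
  \<open>e / 2\<close>.\<close>

lemma continuous_on_SUP_compact:
  fixes g :: "'a::heine_borel \<Rightarrow> 'b::metric_space \<Rightarrow> real"
  assumes g: "continuous_on UNIV (\<lambda>z. g (fst z) (snd z))" and K: "compact K" "K \<noteq> {}"
  shows "continuous_on UNIV (\<lambda>t. SUP p\<in>K. g t p)"
proof -
  have bdd: "bdd_above (g t ` K)" for t
  proof -
    have "continuous_on K (\<lambda>p. g (fst (t, p)) (snd (t, p)))"
      by (rule continuous_on_compose2[OF g]) (auto intro!: continuous_intros)
    then have "compact (g t ` K)"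
      using compact_continuous_image K(1) by auto
    then show ?thesis
      by (simp add: bounded_imp_bdd_above compact_imp_bounded)
  qed
  show ?thesis
    unfolding continuous_on_iff
  proof (intro ballI allI impI)
    fix t :: 'a and e :: real assume "0 < e"
    have "uniformly_continuous_on (cball t 1 \<times> K) (\<lambda>z. g (fst z) (snd z))"
      using K(1) by (intro compact_uniformly_continuous continuous_on_subset[OF g] compact_Times) auto
    then obtain d where d: "d > 0" "\<And>z z'. z \<in> cball t 1 \<times> K \<Longrightarrow> z' \<in> cball t 1 \<times> K
        \<Longrightarrow> dist z' z < d \<Longrightarrow> dist (g (fst z') (snd z')) (g (fst z) (snd z)) < e / 2"
      unfolding uniformly_continuous_on_def using \<open>0 < e\<close> by (metis half_gt_zero)
    have "dist (SUP p\<in>K. g t' p) (SUP p\<in>K. g t p) < e" if "dist t' t < min d 1" for t'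
    proof -
      have close: "\<bar>g t' p - g t p\<bar> < e / 2" if "p \<in> K" for p
        using d(2)[of "(t, p)" "(t', p)"] that \<open>dist t' t < min d 1\<close>
        by (auto simp: dist_Pair_Pair dist_commute dist_real_def)
      have "(SUP p\<in>K. g t' p) \<le> (SUP p\<in>K. g t p) + e / 2"
      proof (rule cSUP_least[OF K(2)])
        fix p assume "p \<in> K"
        then show "g t' p \<le> (SUP p\<in>K. g t p) + e / 2"
          using close[of p] cSUP_upper[OF _ bdd, of p t] by linarith
      qed
      moreover have "(SUP p\<in>K. g t p) \<le> (SUP p\<in>K. g t' p) + e / 2"
      proof (rule cSUP_least[OF K(2)])
        fix p assume "p \<in> K"
        then show "g t p \<le> (SUP p\<in>K. g t' p) + e / 2"
          using close[of p] cSUP_upper[OF _ bdd, of p t'] by linarith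
      qed
      ultimately show ?thesis
        using \<open>0 < e\<close> by (simp add: dist_real_def)
    qed
    then show "\<exists>d>0. \<forall>t'\<in>UNIV. dist t' t < d \<longrightarrow> dist (SUP p\<in>K. g t' p) (SUP p\<in>K. g t p) < e"
      using d(1) by (intro exI[of _ "min d 1"]) auto
  qed
qed

lemma continuous_on_chord_diff:
  fixes u v :: "'a::topological_space \<Rightarrow> real"
  assumes "continuous_on {0..1} f" "continuous_on A u" "continuous_on A v" "n \<ge> 1"
  shows "continuous_on A (\<lambda>z. chord_diff n (f \<circ> clamp01) (u z) (v z))"
  unfolding chord_diff_def
  using assms by (intro continuous_on_fin_diff continuous_on_comp_clamp01 continuous_intros) auto

lemma continuous_on_modulus:
  assumes "continuous_on {0..1} f" "n \<ge> 1"
  shows "continuous_on UNIV (\<lambda>t. modulus n f t r)"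
  unfolding modulus_def
  using assms by (intro continuous_on_SUP_compact continuous_on_rabs continuous_on_chord_diff continuous_intros compact_cbox)
    (auto simp: box_ne_empty Basis_prod_def)

lemma modulus_ge:
  assumes f: "continuous_on {0..1} f" and n: "n \<ge> 1" and "0 < r"
    and a: "a \<in> {0..1}" "\<bar>a - t\<bar> \<le> r" and b: "b \<in> {0..1}" "\<bar>b - t\<bar> \<le> r"
  shows "\<bar>chord_diff n f a b\<bar> \<le> modulus n f t r"
proof -
  let ?k = "\<lambda>p. \<bar>chord_diff n (f \<circ> clamp01) (clamp01 (t + r * fst p)) (clamp01 (t + r * snd p))\<bar>"
  let ?K = "cbox (-1, -1) (1, 1) :: (real \<times> real) set"
  have "continuous_on ?K ?k"
    using f n by (intro continuous_on_rabs continuous_on_chord_diff continuous_intros) auto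
  then have "bdd_above (?k ` ?K)"
    by (intro bounded_imp_bdd_above compact_imp_bounded compact_continuous_image compact_cbox)
  moreover have "((a - t) / r, (b - t) / r) \<in> ?K"
    using a b \<open>0 < r\<close> by (auto simp: field_simps cbox_Pair_eq abs_le_iff)
  ultimately have "?k ((a - t) / r, (b - t) / r) \<le> modulus n f t r"
    unfolding modulus_def by (rule cSUP_upper[rotated])
  then show ?thesis
    using a b n \<open>0 < r\<close> by (simp add: clamp01_id chord_diff_clamp01)
qed

text \<open>For \<open>t\<close> in \<open>[0,1]\<close> clamping fixes \<open>t\<close> and
  increases no distance, so clamped end points stay within \<open>r\<close> of \<open>t\<close>.
  Together with \<open>modulus_ge\<close>, the modulus is the supremum over chords in
  \<open>[0,1]\<close> with both ends within \<open>r\<close> of \<open>t\<close>.\<close>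

lemma modulus_le:
  assumes "n \<ge> 1" "0 < r" "t \<in> {0..1}"
    and M: "\<And>a b. \<lbrakk>a \<in> {0..1}; b \<in> {0..1}; \<bar>a - t\<bar> \<le> r; \<bar>b - t\<bar> \<le> r\<rbrakk> \<Longrightarrow> \<bar>chord_diff n f a b\<bar> \<le> M"
  shows "modulus n f t r \<le> M"
  unfolding modulus_def
proof (rule cSUP_least)
  fix p :: "real \<times> real" assume p: "p \<in> cbox (-1, -1) (1, 1)"
  have *: "\<bar>clamp01 (t + r * s) - t\<bar> \<le> r" if "\<bar>s\<bar> \<le> 1" for s
  proof -
    have "\<bar>clamp01 (t + r * s) - t\<bar> \<le> \<bar>r * s\<bar>"
      using clamp01_nonexpansive[of "t + r * s" t] assms(3) by (simp add: clamp01_id)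
    also have "\<dots> \<le> r"
      using that assms(2) by (simp add: abs_mult mult_left_le)
    finally show ?thesis .
  qed
  have "\<bar>fst p\<bar> \<le> 1" "\<bar>snd p\<bar> \<le> 1"
    using p by (cases p; auto simp: cbox_Pair_eq abs_le_iff)+
  then show "\<bar>chord_diff n (f \<circ> clamp01) (clamp01 (t + r * fst p)) (clamp01 (t + r * snd p))\<bar> \<le> M"
    using M * clamp01_mem assms(1) by (simp add: chord_diff_clamp01)
qed (auto simp: cbox_Pair_eq)

lemma chord_diff_1: "chord_diff (Suc 0) f a b = f b - f a"
  by (simp add: chord_diff_def)

text \<open>Neighbourhoods of 0 and 1 in the line leave the interval. A convex combination with the
  midpoint moves any point into the interior at a cost of at most
  \<open>\<theta> / 2\<close>.\<close>

lemma inward_point: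
  fixes x \<theta> :: real
  assumes "x \<in> {0..1}" "0 < \<theta>" "\<theta> \<le> 1"
  shows "x + \<theta> * (1/2 - x) \<in> {0<..<1}" "\<bar>\<theta> * (1/2 - x)\<bar> \<le> \<theta> / 2"
proof -
  have "0 \<le> (1 - \<theta>) * x" "(1 - \<theta>) * x \<le> 1 - \<theta>"
    using assms by (auto intro: mult_left_le)
  then show "x + \<theta> * (1/2 - x) \<in> {0<..<1}"
    using assms(2) by (auto simp: algebra_simps)
  have "\<bar>1/2 - x\<bar> \<le> 1/2"
    using assms(1) unfolding abs_le_iff by (auto simp: field_simps)
  then have "\<theta> * \<bar>1/2 - x\<bar> \<le> \<theta> * (1/2)"
    using assms(2) by (intro mult_left_mono) auto
  then show "\<bar>\<theta> * (1/2 - x)\<bar> \<le> \<theta> / 2"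
    using assms(2) by (simp add: abs_mult)
qed

section \<open>Essential suprema on the interval compared with moduli\<close>

lemma rel_ball_lebesgue: "rel_ball {0..1} t r \<in> sets lebesgue"
  unfolding rel_ball_def by simp

text \<open>If \<open>\<bar>g x\<bar>\<close> exceeded \<open>c\<close>, it would exceed some
  \<open>d > c\<close> on a relative neighbourhood of \<open>x\<close>. Even when \<open>x\<close>
  is 0 or 1 this neighbourhood meets the interior in a nonempty open set, which an essential bound
  cannot ignore.\<close>

lemma Linf_norm_rel_ball_pointwise:
  assumes g: "continuous_on {0..1} g" and le: "Linf_norm (rel_ball {0..1} t r) g \<le> ennreal c"
    and "0 \<le> c" and x: "x \<in> rel_ball {0..1} t r"
  shows "\<bar>g x\<bar> \<le> c"
proof (rule ccontr)
  assume "\<not> ?thesis"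
  then obtain d where d: "c < d" "d < \<bar>g x\<bar>"
    using dense not_le by metis
  have x01: "x \<in> {0..1}" "x \<in> ball t r"
    using x by (auto simp: rel_ball_def)
  define V where "V = {y. d < \<bar>(g \<circ> clamp01) y\<bar>} \<inter> ball t r"
  have "open {y. d < \<bar>(g \<circ> clamp01) y\<bar>}"
    using g by (intro open_Collect_less continuous_on_const continuous_on_rabs continuous_on_comp_clamp01)
  then have "open V"
    by (auto simp: V_def)
  moreover have "x \<in> V"
    using d x01 by (auto simp: V_def clamp01_id)
  ultimately obtain e where e: "0 < e" "ball x e \<subseteq> V"
    using open_contains_ball by blast
  define \<theta> where "\<theta> = min 1 e"
  have \<theta>: "0 < \<theta>" "\<theta> \<le> 1" "\<theta> \<le> e"
    using e(1) by (auto simp: \<theta>_def)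
  have "x + \<theta> * (1/2 - x) \<in> V"
    using inward_point(2)[OF x01(1) \<theta>(1,2)] \<theta> e by (auto simp: dist_real_def)
  with inward_point(1)[OF x01(1) \<theta>(1,2)] have "V \<inter> {0<..<1} \<noteq> {}"
    by blast
  then have "ennreal d \<le> Linf_norm (rel_ball {0..1} t r) g"
    using \<open>open V\<close>
    by (intro Linf_norm_ge[OF rel_ball_lebesgue, of "V \<inter> {0<..<1}"])
       (auto simp: V_def rel_ball_def clamp01_id)
  with le have "ennreal d \<le> ennreal c"
    by simp
  then show False
    using d(1) \<open>0 \<le> c\<close> by (simp add: ennreal_le_iff)
qed

text \<open>A relative ball in an interval is convex, so only the end points of the segment have to
  be tested.\<close>

lemma diff_ball_iff:
  "x \<in> diff_ball {0..1} n h t r \<longleftrightarrow> x \<in> rel_ball {0..1} t r \<and> x + real n * h \<in> rel_ball {0..1} t r"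
proof -
  have "convex (rel_ball {0..1} t r)"
    unfolding rel_ball_def by (intro convex_Int convex_ball convex_closed_interval)
  then show ?thesis
    unfolding diff_ball_def using closed_segment_subset[of x "rel_ball {0..1} t r" "x + real n * h"] by auto
qed

lemma diff_ball_lebesgue: "diff_ball {0..1} n h t r \<in> sets lebesgue"
proof -
  let ?A = "rel_ball {0..1} t r"
  have A: "?A \<in> sets borel"
    unfolding rel_ball_def by simp
  have "(\<lambda>x. x + real n * h) -` ?A \<inter> space borel \<in> sets borel"
    by (rule measurable_sets[OF _ A]) simp
  moreover have "diff_ball {0..1} n h t r = ?A \<inter> ((\<lambda>x. x + real n * h) -` ?A \<inter> space borel)"
    by (auto simp: diff_ball_iff)
  ultimately have "diff_ball {0..1} n h t r \<in> sets borel"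
    using A by (metis sets.Int)
  then show ?thesis
    by simp
qed

abbreviation irregularity :: "nat \<Rightarrow> (real \<Rightarrow> real) \<Rightarrow> real \<Rightarrow> real \<Rightarrow> ennreal" where
  "irregularity n f t r \<equiv>
     (SUP h\<in>{h. \<bar>h\<bar> \<le> r}. Linf_norm (diff_ball {0..1} n h t r) (fin_diff n h f))"

text \<open>The \<open>n\<close>-th difference at \<open>x\<close> with step \<open>h\<close> is the
  chord difference from \<open>x\<close> to \<open>x + n * h\<close>, and both ends lie within
  \<open>r\<close> of \<open>t\<close>. In this direction no change of radius is necessary.\<close>

lemma irregularity_le_modulus:
  assumes f: "continuous_on {0..1} f" and n: "n \<ge> 1" and r: "0 < r"
  shows "irregularity n f t r \<le> ennreal (modulus n f t r)"
proof (rule SUP_least)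
  fix h :: real
  let ?S = "diff_ball {0..1} n h t r"
  show "Linf_norm ?S (fin_diff n h f) \<le> ennreal (modulus n f t r)"
  proof (rule Linf_norm_le[OF diff_ball_lebesgue])
    have "fin_diff n h (f \<circ> clamp01) x = fin_diff n h f x" if "x \<in> ?S" for x
      using that n by (intro fin_diff_cong_segment) (auto simp: diff_ball_def rel_ball_def clamp01_id)
    moreover have "continuous_on ?S (fin_diff n h (f \<circ> clamp01))"
      by (intro continuous_on_fin_diff continuous_on_comp_clamp01 f continuous_intros)
    ultimately show "continuous_on ?S (fin_diff n h f)"
      by simp
    fix x assume "x \<in> ?S"
    then have "\<bar>chord_diff n f x (x + real n * h)\<bar> \<le> modulus n f t r"
      using r by (intro modulus_ge f n) (auto simp: diff_ball_iff rel_ball_def dist_real_def abs_minus_commute)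
    then show "\<bar>fin_diff n h f x\<bar> \<le> modulus n f t r"
      using n by (simp add: chord_diff_def)
  qed
qed

text \<open>Moving both end points of a chord slightly towards \<open>1/2\<close> places it in the interior
  of \<open>[0,1]\<close> without lengthening it; neighbouring translates of the chord then have
  positive measure.\<close>

lemma modulus_le_irregularity:
  assumes f: "continuous_on {0..1} f" and n: "n \<ge> 1" and \<rho>: "0 < \<rho>" "2 * \<rho> \<le> r"
    and t: "t \<in> {0..1}"
  shows "ennreal (modulus n f t \<rho>) \<le> irregularity n f t r"
proof (rule ccontr)
  assume "\<not> ?thesis"
  then have less: "irregularity n f t r < ennreal (modulus n f t \<rho>)"
    by simp
  then obtain c where c: "irregularity n f t r = ennreal c" "0 \<le> c"
    by (cases "irregularity n f t r") auto
  then have "c < modulus n f t \<rho>"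
    using less by (simp add: ennreal_less_iff)
  then obtain a b where ab: "a \<in> {0..1}" "b \<in> {0..1}" "\<bar>a - t\<bar> \<le> \<rho>" "\<bar>b - t\<bar> \<le> \<rho>"
      "c < \<bar>chord_diff n f a b\<bar>"
    using modulus_le[OF n \<rho>(1) t, of f c] by (meson not_le)
  then obtain d where d: "c < d" "d < \<bar>chord_diff n f a b\<bar>"
    using dense by blast
  let ?F = "f \<circ> clamp01"
  define k where "k = (\<lambda>\<theta>. \<bar>chord_diff n ?F (a + \<theta> * (1/2 - a)) (b + \<theta> * (1/2 - b))\<bar>)"
  have "continuous_on UNIV k"
    unfolding k_def by (intro continuous_on_rabs continuous_on_chord_diff f n continuous_intros)
  then have "(k \<longlongrightarrow> k 0) (at_right 0)"
    by (simp add: continuous_on_eq_continuous_at continuous_at_imp_continuous_at_within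
        continuous_within[symmetric])
  moreover have "d < k 0"
    using d ab n by (simp add: k_def chord_diff_clamp01)
  ultimately have "\<forall>\<^sub>F \<theta> in at_right 0. d < k \<theta>"
    by (rule order_tendstoD)
  \<comment> \<open>The bound \<open>\<theta> < r\<close> serves the open ball: the moved end points
    are at distance at most \<open>\<rho> + \<theta> / 2 < r\<close> from \<open>t\<close>.\<close>
  moreover have "\<forall>\<^sub>F \<theta> in at_right 0. \<theta> \<in> {0<..<min 1 r}"
    using \<rho> by (intro eventually_at_right_real) auto
  ultimately have "\<forall>\<^sub>F \<theta> in at_right (0::real). d < k \<theta> \<and> \<theta> \<in> {0<..<min 1 r}"
    by (rule eventually_conj)
  then obtain \<theta> where \<theta>: "d < k \<theta>" "0 < \<theta>" "\<theta> \<le> 1" "\<theta> < r"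
    using eventually_happens'[OF trivial_limit_at_right_real] by fastforce
  define a' b' where "a' = a + \<theta> * (1/2 - a)" and "b' = b + \<theta> * (1/2 - b)"
  define h where "h = (b' - a') / real n"
  have a': "a' \<in> {0<..<1}" "\<bar>a' - t\<bar> < r" and b': "b' \<in> {0<..<1}" "\<bar>b' - t\<bar> < r"
    using inward_point[OF ab(1) \<theta>(2,3)] inward_point[OF ab(2) \<theta>(2,3)] ab(3,4) \<theta>(4) \<rho>
    unfolding a'_def b'_def by linarith+
  have bh: "a' + real n * h = b'"
    using n by (simp add: h_def)
  \<comment> \<open>The factor 2 in the radius is used here: the irregularity also restricts the
    step to \<open>\<bar>h\<bar> \<le> r\<close>, and a chord with ends within \<open>\<rho>\<close>
    of \<open>t\<close> may have length \<open>2 * \<rho>\<close>.\<close>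
  have "b' - a' = (1 - \<theta>) * (b - a)"
    by (simp add: a'_def b'_def algebra_simps)
  moreover have "(1 - \<theta>) * \<bar>b - a\<bar> \<le> 1 * \<bar>b - a\<bar>"
    using \<theta> by (intro mult_right_mono) auto
  ultimately have "\<bar>b' - a'\<bar> \<le> \<bar>b - a\<bar>"
    using \<theta> by (simp add: abs_mult)
  then have "\<bar>b' - a'\<bar> \<le> r"
    using ab(3,4) \<rho> by linarith
  moreover have "\<bar>b' - a'\<bar> / real n \<le> \<bar>b' - a'\<bar>"
    using n by (simp add: divide_le_eq mult_le_cancel_left1)
  ultimately have h: "\<bar>h\<bar> \<le> r"
    by (simp add: h_def)
  define I where "I = {0<..<1} \<inter> ball t r"
  \<comment> \<open>The base points from which the translated chord stays in the interior and its
    difference remains above \<open>d\<close>. This set is an open neighbourhood of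
    \<open>a'\<close>.\<close>
  define U where "U = {x. d < \<bar>fin_diff n h ?F x\<bar>} \<inter> I \<inter> {x. x + real n * h \<in> I}"
  have "open I"
    by (auto simp: I_def)
  moreover have "open ((\<lambda>x. x + real n * h) -` I)"
    using \<open>open I\<close> by (intro open_vimage continuous_intros)
  moreover have "open {x. d < \<bar>fin_diff n h ?F x\<bar>}"
    by (intro open_Collect_less continuous_on_const continuous_on_rabs continuous_on_fin_diff
        continuous_on_comp_clamp01 f continuous_on_id)
  ultimately have "open U"
    unfolding U_def vimage_def by auto
  moreover have "a' \<in> U"
    using a' b' \<theta>(1) bh unfolding U_def I_def k_def chord_diff_def a'_def[symmetric] b'_def[symmetric]
    by (auto simp: dist_real_def h_def)
  moreover have sub: "U \<subseteq> diff_ball {0..1} n h t r"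
    by (auto simp: U_def I_def diff_ball_iff rel_ball_def)
  moreover have "d \<le> \<bar>fin_diff n h f x\<bar>" if "x \<in> U" for x
  proof -
    have "x \<in> diff_ball {0..1} n h t r"
      using that sub by blast
    then have "fin_diff n h f x = fin_diff n h ?F x"
      using n by (intro fin_diff_cong_segment) (auto simp: diff_ball_def rel_ball_def clamp01_id)
    then show ?thesis
      using that by (simp add: U_def)
  qed
  ultimately have "ennreal d \<le> Linf_norm (diff_ball {0..1} n h t r) (fin_diff n h f)"
    by (intro Linf_norm_ge[OF diff_ball_lebesgue, of U]) auto
  also have "\<dots> \<le> irregularity n f t r"
    using h by (intro SUP_upper) auto
  finally show False
    using c d by (simp add: ennreal_le_iff)
qed

subsection \<open>Exponents read off at dyadic scales\<close>

text \<open>The truncation at \<open>2\<^sup>-\<^sup>j\<^sup>2\<close> keeps the exponent finite when the modulus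
  vanishes, without affecting its asymptotic behaviour.\<close>

definition scale_exponent :: "nat \<Rightarrow> real \<Rightarrow> real" where
  "scale_exponent j p = - log 2 (max p (2 powr - (real j)\<^sup>2)) / real j"

text \<open>For \<open>\<beta> < real j\<close> the truncation value lies strictly below the
  threshold \<open>2 powr - (real j * \<beta>)\<close>, so the comparison does not see the
  truncation. The reverse comparison below works in the same way.\<close>

lemma scale_exponent_gt_iff:
  assumes "0 < j" "\<beta> < real j"
  shows "\<beta> < scale_exponent j p \<longleftrightarrow> p < 2 powr - (real j * \<beta>)"
proof -
  have "\<beta> < scale_exponent j p \<longleftrightarrow> log 2 (max p (2 powr - (real j)\<^sup>2)) < - (real j * \<beta>)"
    using assms(1) by (auto simp: scale_exponent_def field_simps)
  also have "\<dots> \<longleftrightarrow> max p (2 powr - (real j)\<^sup>2) < 2 powr - (real j * \<beta>)"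
    by (rule log_less_iff) (auto simp: less_max_iff_disj)
  also have "\<dots> \<longleftrightarrow> p < 2 powr - (real j * \<beta>)"
    using assms by (simp add: power2_eq_square)
  finally show ?thesis .
qed

lemma scale_exponent_less_iff:
  assumes "0 < j" "\<beta> < real j"
  shows "scale_exponent j p < \<beta> \<longleftrightarrow> 2 powr - (real j * \<beta>) < p"
proof -
  have "scale_exponent j p < \<beta> \<longleftrightarrow> - (real j * \<beta>) < log 2 (max p (2 powr - (real j)\<^sup>2))"
    using assms(1) by (auto simp: scale_exponent_def field_simps)
  also have "\<dots> \<longleftrightarrow> 2 powr - (real j * \<beta>) < max p (2 powr - (real j)\<^sup>2)"
    by (rule less_log_iff) (auto simp: less_max_iff_disj)
  also have "\<dots> \<longleftrightarrow> 2 powr - (real j * \<beta>) < p"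
    using assms by (auto simp: power2_eq_square less_max_iff_disj)
  finally show ?thesis .
qed

lemma continuous_on_scale_exponent:
  assumes "continuous_on A p"
  shows "continuous_on A (\<lambda>t. scale_exponent j (p t))"
proof -
  have "max (p t) (2 powr - (real j)\<^sup>2) \<noteq> 0" for t
    by (smt (verit) powr_gt_zero)
  then show ?thesis
    unfolding scale_exponent_def log_def using assms
    by (cases "j = 0") (auto intro!: continuous_intros)
qed

lemma ex_dyadic_scale:
  assumes "0 < r" "r \<le> 2 powr - real k"
  shows "\<exists>j\<ge>k. 2 powr - real (Suc j) < r \<and> r \<le> 2 powr - real j"
proof (intro exI conjI)
  let ?j = "nat \<lfloor>- log 2 r\<rfloor>"
  have "log 2 r \<le> - real k"
    using assms by (subst log_le_iff) auto
  then have *: "real ?j \<le> - log 2 r" "- log 2 r < real ?j + 1" "real k < real ?j + 1"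
    by linarith+
  show "k \<le> ?j"
    using *(3) by simp
  show "2 powr - real (Suc ?j) < r"
    using *(2) assms(1) by (subst less_log_iff[symmetric]) auto
  show "r \<le> 2 powr - real ?j"
    using *(1) assms(1) by (subst log_le_iff[symmetric]) auto
qed

text \<open>Multiplicative constants are absorbed by an arbitrarily small loss in the exponent; only
  the exponential rate of a modulus matters.\<close>

lemma eventually_powr_less:
  fixes \<alpha> \<beta> K :: real
  assumes "\<beta> < \<alpha>" "0 < K"
  shows "\<forall>\<^sub>F j in sequentially. K * 2 powr - (real j * \<alpha>) < 2 powr - (real j * \<beta>)"
  using eventually_gt_at_top[of "nat \<lceil>log 2 K / (\<alpha> - \<beta>)\<rceil>"]
proof eventually_elim
  case (elim j)
  then have "log 2 K / (\<alpha> - \<beta>) < real j"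
    by linarith
  then have "log 2 K < real j * (\<alpha> - \<beta>)"
    using assms by (simp add: field_simps)
  then have "K < 2 powr (real j * (\<alpha> - \<beta>))"
    using assms by (simp add: log_less_iff)
  then have "K * 2 powr - (real j * \<alpha>) < 2 powr (real j * (\<alpha> - \<beta>)) * 2 powr - (real j * \<alpha>)"
    by simp
  also have "\<dots> = 2 powr - (real j * \<beta>)"
    by (simp add: powr_add[symmetric] algebra_simps)
  finally show ?case .
qed

lemma eventually_dyadic_le:
  assumes "0 < (R::real)"
  shows "\<forall>\<^sub>F j in sequentially. 2 powr - real j \<le> R"
  using eventually_powr_less[of 0 1 "1 / R"] assms
  by (auto elim!: eventually_mono simp: field_simps)

section \<open>Local exponents and the irregularity condition\<close>

definition local_exponent :: "nat \<Rightarrow> (real \<Rightarrow> real) \<Rightarrow> real \<Rightarrow> nat \<Rightarrow> real" where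
  "local_exponent n f t j = scale_exponent j (modulus n f t (2 powr - real j))"

lemma continuous_on_local_exponent:
  assumes "continuous_on {0..1} f" "n \<ge> 1"
  shows "continuous_on UNIV (\<lambda>t. local_exponent n f t j)"
  unfolding local_exponent_def
  using assms by (intro continuous_on_scale_exponent continuous_on_modulus)

lemma eventually_less_nat: "\<forall>\<^sub>F j in sequentially. 0 < j \<and> \<beta> < real j"
  using eventually_gt_at_top[of "nat \<lceil>max 0 \<beta>\<rceil>"]
  by eventually_elim linarith

lemma eventually_local_exponent_gt_iff:
  "\<forall>\<^sub>F j in sequentially. \<beta> < local_exponent n f t j \<longleftrightarrow>
     modulus n f t (2 powr - real j) < 2 powr - (real j * \<beta>)"
  using eventually_less_nat[of \<beta>]
  by eventually_elim (simp add: local_exponent_def scale_exponent_gt_iff)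

lemma eventually_local_exponent_less_iff:
  "\<forall>\<^sub>F j in sequentially. local_exponent n f t j < \<beta> \<longleftrightarrow>
     2 powr - (real j * \<beta>) < modulus n f t (2 powr - real j)"
  using eventually_less_nat[of \<beta>]
  by eventually_elim (simp add: local_exponent_def scale_exponent_less_iff)

text \<open>If the limit superior exceeded some \<open>\<beta> > \<alpha>\<close>, the modulus would
  be below \<open>2 powr - (real j * \<beta>)\<close> at infinitely many scales, contradicting the
  lower bound of order \<open>\<alpha>\<close> required at every small radius.\<close>

lemma irregular_at_imp_limsup_le:
  assumes f: "continuous_on {0..1} f" and irr: "irregular_at {0..1} \<alpha> f t"
  shows "limsup (\<lambda>j. ereal (local_exponent (nat \<lfloor>\<alpha>\<rfloor> + 1) f t j)) \<le> ereal \<alpha>"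
proof (rule ccontr)
  define n where "n = nat \<lfloor>\<alpha>\<rfloor> + 1"
  assume "\<not> ?thesis"
  then have "ereal \<alpha> < limsup (\<lambda>j. ereal (local_exponent n f t j))"
    by (simp add: n_def)
  then obtain \<beta> where \<beta>: "ereal \<alpha> < ereal \<beta>" "ereal \<beta> < limsup (\<lambda>j. ereal (local_exponent n f t j))"
    using ereal_dense2 by blast
  have freq: "\<exists>\<^sub>F j in sequentially. \<beta> < local_exponent n f t j"
  proof (rule ccontr)
    assume "\<not> ?thesis"
    then have "\<forall>\<^sub>F j in sequentially. ereal (local_exponent n f t j) \<le> ereal \<beta>"
      by (simp add: frequently_def not_less)
    then have "limsup (\<lambda>j. ereal (local_exponent n f t j)) \<le> ereal \<beta>"
      by (rule Limsup_bounded)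
    with \<beta>(2) show False
      by simp
  qed
  obtain C R where C: "0 < C" "0 < R"
    and CR: "\<And>r. 0 < r \<Longrightarrow> r \<le> R \<Longrightarrow> ennreal (C * r powr \<alpha>) \<le> irregularity n f t r"
    using irr unfolding irregular_at_def n_def by (auto simp: Let_def)
  have "\<forall>\<^sub>F j in sequentially. (1 / C) * 2 powr - (real j * \<beta>) < 2 powr - (real j * \<alpha>)"
    using \<beta>(1) C by (intro eventually_powr_less) auto
  then have "\<forall>\<^sub>F j in sequentially. 2 powr - real j \<le> R \<and>
     (1 / C) * 2 powr - (real j * \<beta>) < 2 powr - (real j * \<alpha>) \<and>
     (\<beta> < local_exponent n f t j \<longleftrightarrow> modulus n f t (2 powr - real j) < 2 powr - (real j * \<beta>))"
    using eventually_dyadic_le[OF C(2)] eventually_local_exponent_gt_iff[of \<beta> n f t]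
    by eventually_elim blast
  from frequently_ex[OF frequently_eventually_conj[OF freq this]]
  obtain j where j: "2 powr - real j \<le> R" "(1 / C) * 2 powr - (real j * \<beta>) < 2 powr - (real j * \<alpha>)"
      "modulus n f t (2 powr - real j) < 2 powr - (real j * \<beta>)"
    by auto
  have "ennreal (C * (2 powr - real j) powr \<alpha>) \<le> ennreal (modulus n f t (2 powr - real j))"
    using CR[of "2 powr - real j"] irregularity_le_modulus[OF f, of n "2 powr - real j" t] j(1)
    by (auto simp: n_def)
  moreover have "0 < C * (2 powr - real j) powr \<alpha>"
    using C by simp
  ultimately have "C * (2 powr - real j) powr \<alpha> \<le> modulus n f t (2 powr - real j)"
    by (auto simp: ennreal_le_iff2)
  with j(2,3) C show False
    by (simp add: powr_powr field_simps)
qed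

text \<open>The strict inequality gives a lower bound for the modulus at all sufficiently fine
  dyadic scales. Arbitrary radii are reached by passing to a comparable dyadic one, which costs only
  a constant factor.\<close>

lemma limsup_less_imp_irregular_at:
  assumes f: "continuous_on {0..1} f" and t: "t \<in> {0..1}" and \<alpha>: "0 \<le> \<alpha>"
    and less: "limsup (\<lambda>j. ereal (local_exponent (nat \<lfloor>\<alpha>\<rfloor> + 1) f t j)) < ereal \<alpha>"
  shows "irregular_at {0..1} \<alpha> f t"
proof -
  define n where "n = nat \<lfloor>\<alpha>\<rfloor> + 1"
  have n: "n \<ge> 1"
    by (simp add: n_def)
  have "\<forall>\<^sub>F j in sequentially. ereal (local_exponent n f t j) < ereal \<alpha>"
    using less unfolding n_def by (rule Limsup_lessD)
  then have "\<forall>\<^sub>F j in sequentially. 2 powr - (real j * \<alpha>) < modulus n f t (2 powr - real j)"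
    using eventually_local_exponent_less_iff[of n f t \<alpha>] by eventually_elim auto
  then obtain k where k: "\<And>j. j \<ge> k \<Longrightarrow> 2 powr - (real j * \<alpha>) < modulus n f t (2 powr - real j)"
    by (auto simp: eventually_sequentially)
  have "ennreal (4 powr - \<alpha> * r powr \<alpha>) \<le> irregularity n f t r"
    if r: "0 < r" "r \<le> 2 powr - real k" for r
  proof -
    obtain j where j: "j \<ge> k" "2 powr - real (Suc j) < r" "r \<le> 2 powr - real j"
      using ex_dyadic_scale[OF r] by blast
    \<comment> \<open>Two levels below \<open>j\<close> meet both needs: twice
      \<open>2 powr - real (j + 2)\<close> is still below \<open>r\<close>, as the comparison with
      the irregularity demands, and \<open>r / 4\<close> does not exceed that radius. This yields
      the constant \<open>4 powr - \<alpha>\<close>.\<close>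
    have eq: "2 powr - real j = 4 * 2 powr - real (j + 2)" "2 powr - real (Suc j) = 2 * 2 powr - real (j + 2)"
      by (simp_all add: powr_minus powr_add powr_diff field_simps)
    have "4 powr - \<alpha> * r powr \<alpha> = (r / 4) powr \<alpha>"
      using r by (simp add: powr_divide powr_minus field_simps)
    also have "\<dots> \<le> (2 powr - real (j + 2)) powr \<alpha>"
      using r j eq \<alpha> by (intro powr_mono2) auto
    also have "\<dots> = 2 powr - (real (j + 2) * \<alpha>)"
      by (simp only: powr_powr minus_mult_left)
    also have "\<dots> \<le> modulus n f t (2 powr - real (j + 2))"
      using k[of "j + 2"] j(1) by simp
    finally have "ennreal (4 powr - \<alpha> * r powr \<alpha>) \<le> ennreal (modulus n f t (2 powr - real (j + 2)))"
      by (rule ennreal_leI)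
    also have "\<dots> \<le> irregularity n f t r"
      using j eq by (intro modulus_le_irregularity f n t) auto
    finally show ?thesis .
  qed
  then have "\<exists>C>0. \<exists>R>0. \<forall>r. 0 < r \<and> r \<le> R \<longrightarrow> ennreal (C * r powr \<alpha>) \<le> irregularity n f t r"
    by (intro exI[of _ "4 powr - \<alpha>"] exI[of _ "2 powr - real k"] conjI) auto
  then show ?thesis
    unfolding irregular_at_def n_def by (simp add: Let_def)
qed

section \<open>First differences and the lower exponent\<close>

lemma abs_diff_le_modulus:
  assumes "continuous_on {0..1} f" "0 < r" "t \<in> {0..1}" "x \<in> {0..1}" "\<bar>x - t\<bar> \<le> r"
  shows "\<bar>f x - f t\<bar> \<le> modulus 1 f t r"
  using modulus_ge[of f 1 r t t x] assms by (simp add: chord_diff_1)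

text \<open>The constant \<open>c\<close> stands for a polynomial of degree 0; it cancels in first
  differences, where the triangle inequality doubles the bound. Any exponent
  \<open>\<beta> < \<alpha>\<close> then absorbs the constant.\<close>

lemma liminf_local_exponent_ge:
  assumes t: "t \<in> {0..1}" and R: "0 < R"
    and K: "\<And>r x. \<lbrakk>0 < r; r \<le> R; x \<in> {0..1}; \<bar>x - t\<bar> \<le> r\<rbrakk> \<Longrightarrow> \<bar>f x - c\<bar> \<le> K * r powr \<alpha>"
  shows "ereal \<alpha> \<le> liminf (\<lambda>j. ereal (local_exponent 1 f t j))"
  unfolding le_Liminf_iff
proof (intro allI impI)
  fix y assume "y < ereal \<alpha>"
  then obtain \<beta> where \<beta>: "y < ereal \<beta>" "ereal \<beta> < ereal \<alpha>"
    using ereal_dense2 by blast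
  \<comment> \<open>Adding 1 keeps the constant positive when \<open>K\<close> is 0.\<close>
  have "\<forall>\<^sub>F j in sequentially. (2 * \<bar>K\<bar> + 1) * 2 powr - (real j * \<alpha>) < 2 powr - (real j * \<beta>)"
    using \<beta> by (intro eventually_powr_less) auto
  then show "\<forall>\<^sub>F j in sequentially. y < ereal (local_exponent 1 f t j)"
    using eventually_dyadic_le[OF R] eventually_local_exponent_gt_iff[of \<beta> 1 f t]
  proof eventually_elim
    case (elim j)
    have "modulus 1 f t (2 powr - real j) \<le> 2 * \<bar>K\<bar> * 2 powr - (real j * \<alpha>)"
    proof (rule modulus_le)
      fix a b assume ab: "a \<in> {0..1}" "b \<in> {0..1}"
        "\<bar>a - t\<bar> \<le> 2 powr - real j" "\<bar>b - t\<bar> \<le> 2 powr - real j"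
      have "\<bar>f x - c\<bar> \<le> \<bar>K\<bar> * 2 powr - (real j * \<alpha>)" if "x \<in> {0..1}" "\<bar>x - t\<bar> \<le> 2 powr - real j" for x
      proof -
        have "\<bar>f x - c\<bar> \<le> K * (2 powr - real j) powr \<alpha>"
          using K[of "2 powr - real j" x] that elim(2) by simp
        also have "\<dots> = K * 2 powr - (real j * \<alpha>)"
          by (simp only: powr_powr minus_mult_left)
        also have "\<dots> \<le> \<bar>K\<bar> * 2 powr - (real j * \<alpha>)"
          by (intro mult_right_mono) auto
        finally show ?thesis .
      qed
      from this[OF ab(1,3)] this[OF ab(2,4)] show "\<bar>chord_diff 1 f a b\<bar> \<le> 2 * \<bar>K\<bar> * 2 powr - (real j * \<alpha>)"
        by (simp add: chord_diff_1)
    qed (use t in auto)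
    also have "\<dots> \<le> (2 * \<bar>K\<bar> + 1) * 2 powr - (real j * \<alpha>)"
      by (intro mult_right_mono) auto
    finally show ?case
      using elim \<beta>(1) by (meson ereal_less(2) le_less_trans less_ereal.simps(1) less_trans)
  qed
qed

text \<open>The converse passage from scales to radii: rounding \<open>r\<close> up to a dyadic
  scale at most doubles it, which accounts for the factor \<open>2 powr \<beta>\<close>.\<close>

lemma less_liminf_local_exponent:
  assumes f: "continuous_on {0..1} f" and t: "t \<in> {0..1}" and \<beta>: "0 \<le> \<beta>"
    and less: "ereal \<beta> < liminf (\<lambda>j. ereal (local_exponent 1 f t j))"
  obtains R where "0 < R"
    "\<And>r x. \<lbrakk>0 < r; r \<le> R; x \<in> {0..1}; \<bar>x - t\<bar> \<le> r\<rbrakk> \<Longrightarrow> \<bar>f x - f t\<bar> \<le> 2 powr \<beta> * r powr \<beta>"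
proof -
  have "\<forall>\<^sub>F j in sequentially. ereal \<beta> < ereal (local_exponent 1 f t j)"
    using less by (rule less_LiminfD)
  then have "\<forall>\<^sub>F j in sequentially. modulus 1 f t (2 powr - real j) < 2 powr - (real j * \<beta>)"
    using eventually_local_exponent_gt_iff[of \<beta> 1 f t] by eventually_elim auto
  then obtain k where k: "\<And>j. j \<ge> k \<Longrightarrow> modulus 1 f t (2 powr - real j) < 2 powr - (real j * \<beta>)"
    by (auto simp: eventually_sequentially)
  show thesis
  proof (rule that[of "2 powr - real k"])
    fix r x assume r: "0 < r" "r \<le> 2 powr - real k" and x: "x \<in> {0..1}" "\<bar>x - t\<bar> \<le> r"
    obtain j where j: "j \<ge> k" "2 powr - real (Suc j) < r" "r \<le> 2 powr - real j"
      using ex_dyadic_scale[OF r] by blast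
    have "\<bar>f x - f t\<bar> \<le> modulus 1 f t (2 powr - real j)"
      using j x t by (intro abs_diff_le_modulus f) auto
    also have "\<dots> \<le> 2 powr - (real j * \<beta>)"
      using k[OF j(1)] by simp
    also have "\<dots> = (2 * 2 powr - real (Suc j)) powr \<beta>"
    proof -
      have "2 * 2 powr - real (Suc j) = (2::real) powr - real j"
        by (simp add: powr_minus_divide powr_diff)
      then show ?thesis
        by (simp only: powr_powr minus_mult_left)
    qed
    also have "\<dots> \<le> (2 * r) powr \<beta>"
      using j \<beta> by (intro powr_mono2) auto
    also have "\<dots> = 2 powr \<beta> * r powr \<beta>"
      using r by (simp add: powr_mult)
    finally show "\<bar>f x - f t\<bar> \<le> 2 powr \<beta> * r powr \<beta>" .
  qed simp
qed

text \<open>The difference quotient at \<open>t\<close> is at most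
  \<open>K * \<bar>y - t\<bar> powr (\<alpha> - 1)\<close>, which tends to 0. With \<open>g\<close>
  the difference of \<open>f\<close> and a polynomial, this shows that a regularity order above 1
  forces differentiability of \<open>f\<close>.\<close>

lemma powr_decay_imp_deriv_zero:
  assumes R: "0 < R" and \<alpha>: "1 < \<alpha>" and t: "t \<in> {0..1}"
    and K: "\<And>r x. \<lbrakk>0 < r; r \<le> R; x \<in> {0..1}; \<bar>x - t\<bar> \<le> r\<rbrakk> \<Longrightarrow> \<bar>g x\<bar> \<le> K * r powr \<alpha>"
  shows "(g has_real_derivative 0) (at t within {0..1})"
  unfolding has_field_derivative_iff
proof (rule Lim_null_comparison)
  \<comment> \<open>The bound at \<open>x = t\<close> holds for every small \<open>r\<close>; let
    \<open>r\<close> tend to 0.\<close>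
  have gt: "g t = 0"
  proof -
    have "((\<lambda>r. K * r powr \<alpha>) \<longlongrightarrow> K * 0 powr \<alpha>) (at_right 0)"
      using \<alpha> by (intro tendsto_intros tendsto_powr2) (auto simp: eventually_at_filter)
    moreover have "\<forall>\<^sub>F r in at_right 0. \<bar>g t\<bar> \<le> K * r powr \<alpha>"
      using eventually_at_right_real[OF R] by eventually_elim (use K[of _ t] t in auto)
    ultimately have "\<bar>g t\<bar> \<le> K * 0 powr \<alpha>"
      by (rule tendsto_lowerbound) simp
    then show ?thesis
      by simp
  qed
  have "\<forall>\<^sub>F y in at t within {0..1}. y \<in> {0..1} \<and> y \<noteq> t \<and> dist y t < R"
    using R by (auto simp: eventually_at intro!: exI[of _ R])
  then show "\<forall>\<^sub>F y in at t within {0..1}. norm ((g y - g t) / (y - t)) \<le> K * \<bar>y - t\<bar> powr (\<alpha> - 1)"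
  proof eventually_elim
    case (elim y)
    then have "\<bar>g y\<bar> \<le> K * \<bar>y - t\<bar> powr \<alpha>"
      using K[of "\<bar>y - t\<bar>" y] by (auto simp: dist_real_def)
    then show ?case
      using elim gt by (simp add: powr_diff field_simps)
  qed
  have "((\<lambda>y. K * \<bar>y - t\<bar> powr (\<alpha> - 1)) \<longlongrightarrow> K * \<bar>t - t\<bar> powr (\<alpha> - 1)) (at t within {0..1})"
    using \<alpha> by (intro tendsto_intros tendsto_powr2) auto
  then show "((\<lambda>y. K * \<bar>y - t\<bar> powr (\<alpha> - 1)) \<longlongrightarrow> 0) (at t within {0..1})"
    by simp
qed

lemma liminf_local_exponent_le_1:
  assumes f: "continuous_on {0..1} f" and t: "t \<in> {0..1}"
    and nd: "\<not> f differentiable (at t within {0..1})"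
  shows "liminf (\<lambda>j. ereal (local_exponent 1 f t j)) \<le> 1" (is "?l \<le> _")
proof (rule ccontr)
  assume "\<not> ?thesis"
  then have "ereal 1 < ?l"
    by (simp add: one_ereal_def)
  then obtain \<beta> where \<beta>: "ereal 1 < ereal \<beta>" "ereal \<beta> < ?l"
    using ereal_dense2 by blast
  then obtain R where "0 < R"
    "\<And>r x. \<lbrakk>0 < r; r \<le> R; x \<in> {0..1}; \<bar>x - t\<bar> \<le> r\<rbrakk> \<Longrightarrow> \<bar>f x - f t\<bar> \<le> 2 powr \<beta> * r powr \<beta>"
    using less_liminf_local_exponent[OF f t, of \<beta>] by auto
  then have "((\<lambda>x. f x - f t) has_real_derivative 0) (at t within {0..1})"
    using \<beta>(1) t by (intro powr_decay_imp_deriv_zero[of R \<beta>]) auto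
  then have "((\<lambda>x. (f x - f t) + f t) has_real_derivative 0 + 0) (at t within {0..1})"
    by (intro DERIV_add DERIV_const)
  with nd show False
    by (auto simp: real_differentiable_def)
qed

text \<open>The essential bound is used on the open ball of radius \<open>2 * r\<close>, which
  contains all points at distance at most \<open>r\<close>. Hence \<open>R\<close> is halved and
  \<open>2 powr \<alpha>\<close> enters the constant.\<close>

lemma hoelder_at_pointwise:
  assumes f: "continuous_on {0..1} f" and "0 \<le> \<alpha>" and "hoelder_at {0..1} \<alpha> f t"
  obtains K R P where "0 < R" "degree_less P \<alpha>"
    "\<And>r x. \<lbrakk>0 < r; r \<le> R; x \<in> {0..1}; \<bar>x - t\<bar> \<le> r\<rbrakk> \<Longrightarrow> \<bar>f x - poly P x\<bar> \<le> K * r powr \<alpha>"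
proof -
  obtain C R P where C: "0 < C" "0 < R" "degree_less P \<alpha>"
    and le: "\<And>r. 0 < r \<Longrightarrow> r \<le> R \<Longrightarrow>
      Linf_norm (rel_ball {0..1} t r) (\<lambda>x. f x - poly P x) \<le> ennreal (C * r powr \<alpha>)"
    using assms(3) unfolding hoelder_at_def by blast
  show thesis
  proof (rule that[where R = "R / 2" and P = P and K = "C * 2 powr \<alpha>"])
    fix r x assume r: "0 < r" "r \<le> R / 2" and x: "x \<in> {0..1}" "\<bar>x - t\<bar> \<le> r"
    have "\<bar>f x - poly P x\<bar> \<le> C * (2 * r) powr \<alpha>"
    proof (rule Linf_norm_rel_ball_pointwise[where g = "\<lambda>x. f x - poly P x"])
      show "Linf_norm (rel_ball {0..1} t (2 * r)) (\<lambda>x. f x - poly P x) \<le> ennreal (C * (2 * r) powr \<alpha>)"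
        using le[of "2 * r"] r by simp
    qed (use C r x in \<open>auto intro!: continuous_intros f simp: rel_ball_def dist_real_def\<close>)
    then show "\<bar>f x - poly P x\<bar> \<le> C * 2 powr \<alpha> * r powr \<alpha>"
      using r by (simp add: powr_mult)
  qed (use C in auto)
qed

text \<open>Orders above 1 are excluded, since subtracting the polynomial would show
  \<open>f\<close> to be differentiable at \<open>t\<close>. For orders up to 1 the polynomial is
  constant, and the condition only concerns the decay of first differences.\<close>

lemma lower_hoelder_exponent_eq_liminf:
  assumes f: "continuous_on {0..1} f" and t: "t \<in> {0..1}"
    and nd: "\<not> f differentiable (at t within {0..1})"
  shows "lower_hoelder_exponent {0..1} f t = liminf (\<lambda>j. ereal (local_exponent 1 f t j))"
    (is "_ = ?l")
  unfolding lower_hoelder_exponent_def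
proof (rule antisym)
  show "Sup {ereal \<alpha> |\<alpha>. 0 \<le> \<alpha> \<and> hoelder_at {0..1} \<alpha> f t} \<le> ?l"
  proof (rule Sup_least, clarify)
    fix \<alpha> :: real assume \<alpha>: "0 \<le> \<alpha>" "hoelder_at {0..1} \<alpha> f t"
    obtain K R P where R: "0 < R" and P: "degree_less P \<alpha>"
      and K: "\<And>r x. \<lbrakk>0 < r; r \<le> R; x \<in> {0..1}; \<bar>x - t\<bar> \<le> r\<rbrakk> \<Longrightarrow> \<bar>f x - poly P x\<bar> \<le> K * r powr \<alpha>"
      using hoelder_at_pointwise[OF f \<alpha>] by metis
    show "ereal \<alpha> \<le> ?l"
    proof (cases "\<alpha> \<le> 1")
      case True
      then have "degree P = 0"
        using P by (auto simp: degree_less_def)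
      then obtain c where "P = [:c:]"
        by (rule degree_eq_zeroE)
      then show ?thesis
        using liminf_local_exponent_ge[OF t R, of f c K \<alpha>] K by simp
    next
      case False
      then have "((\<lambda>x. f x - poly P x) has_real_derivative 0) (at t within {0..1})"
        by (intro powr_decay_imp_deriv_zero[OF R _ t K]) auto
      then have "((\<lambda>x. (f x - poly P x) + poly P x) has_real_derivative 0 + poly (pderiv P) t) (at t within {0..1})"
        by (intro DERIV_add has_field_derivative_at_within[OF poly_DERIV])
      then have "f differentiable (at t within {0..1})"
        by (auto simp: real_differentiable_def)
      with nd show ?thesis
        by contradiction
    qed
  qed
next
  let ?S = "{ereal \<alpha> |\<alpha>. 0 \<le> \<alpha> \<and> hoelder_at {0..1} \<alpha> f t}"
  \<comment> \<open>Order 0 always qualifies, \<open>f\<close> being bounded. This settles the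
    values below the limit inferior for which no positive \<open>\<beta>\<close> is at hand.\<close>
  have zero: "0 \<le> Sup ?S"
  proof -
    have "bounded (f ` {0..1})"
      using f by (intro compact_imp_bounded compact_continuous_image) auto
    then obtain B where B: "0 < B" "\<And>x. x \<in> {0..1} \<Longrightarrow> \<bar>f x\<bar> \<le> B"
      by (auto simp: bounded_pos)
    have "Linf_norm (rel_ball {0..1} t r) (\<lambda>x. f x - poly 0 x) \<le> ennreal (B * r powr 0)" if "0 < r" for r
      using B that by (intro Linf_norm_le rel_ball_lebesgue)
        (auto simp: rel_ball_def intro!: continuous_on_subset[OF f])
    then have "hoelder_at {0..1} 0 f t"
      using B(1) unfolding hoelder_at_def
      by (intro exI[of _ B] conjI exI[of _ 1] exI[of _ 0]) (auto simp: degree_less_def)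
    then show ?thesis
      by (intro Sup_upper) auto
  qed
  show "?l \<le> Sup ?S"
  proof (rule dense_le)
    fix y assume "y < ?l"
    then obtain \<beta> where \<beta>: "y < ereal \<beta>" "ereal \<beta> < ?l"
      using ereal_dense2 by blast
    show "y \<le> Sup ?S"
    proof (cases "0 < \<beta>")
      case True
      then obtain R where R: "0 < R"
        and K: "\<And>r x. \<lbrakk>0 < r; r \<le> R; x \<in> {0..1}; \<bar>x - t\<bar> \<le> r\<rbrakk> \<Longrightarrow> \<bar>f x - f t\<bar> \<le> 2 powr \<beta> * r powr \<beta>"
        using less_liminf_local_exponent[OF f t _ \<beta>(2)] by auto
      have "Linf_norm (rel_ball {0..1} t r) (\<lambda>x. f x - poly [:f t:] x) \<le> ennreal (2 powr \<beta> * r powr \<beta>)"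
        if "0 < r" "r \<le> R" for r
        using K[OF that] by (intro Linf_norm_le rel_ball_lebesgue)
          (auto simp: rel_ball_def dist_real_def abs_minus_commute intro!: continuous_intros continuous_on_subset[OF f])
      then have "hoelder_at {0..1} \<beta> f t"
        using R True unfolding hoelder_at_def
        by (intro exI[of _ "2 powr \<beta>"] conjI exI[of _ R] exI[of _ "[:f t:]"]) (auto simp: degree_less_def)
      then have "ereal \<beta> \<le> Sup ?S"
        using True by (intro Sup_upper) auto
      then show ?thesis
        using \<beta>(1) by simp
    next
      case False
      then have "ereal \<beta> \<le> 0"
        by simp
      with \<beta>(1) have "y \<le> 0"
        by (rule order.strict_implies_order[OF less_le_trans])
      then show ?thesis
        using zero by (rule order.trans)
    qed
  qed
qed

text \<open>Orders \<open>\<alpha> < 1\<close> involve first differences only, and orders from 1 on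
  lie above the limit superior anyway. The infimum is approached by orders between the limit
  superior and 1.\<close>

lemma upper_hoelder_exponent_eq_limsup:
  assumes f: "continuous_on {0..1} f" and t: "t \<in> {0..1}"
    and nonneg: "0 \<le> limsup (\<lambda>j. ereal (local_exponent 1 f t j))"
    and less1: "limsup (\<lambda>j. ereal (local_exponent 1 f t j)) < 1"
  shows "upper_hoelder_exponent {0..1} f t = limsup (\<lambda>j. ereal (local_exponent 1 f t j))"
    (is "_ = ?u")
  unfolding upper_hoelder_exponent_def
proof (rule antisym)
  have floor: "nat \<lfloor>\<alpha>\<rfloor> + 1 = 1" if "0 \<le> \<alpha>" "\<alpha> < 1" for \<alpha> :: real
    using that by linarith
  let ?S = "{ereal \<alpha> |\<alpha>. 0 \<le> \<alpha> \<and> irregular_at {0..1} \<alpha> f t}"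
  show "?u \<le> Inf ?S"
  proof (rule Inf_greatest, clarify)
    fix \<alpha> :: real assume \<alpha>: "0 \<le> \<alpha>" "irregular_at {0..1} \<alpha> f t"
    show "?u \<le> ereal \<alpha>"
    proof (cases "\<alpha> < 1")
      case True
      then show ?thesis
        using irregular_at_imp_limsup_le[OF f \<alpha>(2)] floor[OF \<alpha>(1)] by simp
    next
      case False
      then have "1 \<le> ereal \<alpha>"
        by (simp add: one_ereal_def)
      with less1 show ?thesis
        by (rule order.trans[OF less_imp_le])
    qed
  qed
  show "Inf ?S \<le> ?u"
  proof (rule dense_ge)
    fix y assume "?u < y"
    with less1 have "?u < min y 1"
      by simp
    then obtain \<alpha> where \<alpha>: "?u < ereal \<alpha>" "ereal \<alpha> < min y 1"
      using ereal_dense2 by blast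
    have "0 < ereal \<alpha>" "ereal \<alpha> < 1"
      using \<alpha> le_less_trans[OF nonneg \<alpha>(1)] by auto
    then have "0 \<le> \<alpha>" "\<alpha> < 1"
      by (simp_all add: one_ereal_def zero_ereal_def)
    then have "irregular_at {0..1} \<alpha> f t"
      using limsup_less_imp_irregular_at[OF f t, of \<alpha>] floor \<alpha>(1) by simp
    then have "Inf ?S \<le> ereal \<alpha>"
      using \<open>0 \<le> \<alpha>\<close> by (intro Inf_lower) auto
    also have "\<dots> \<le> y"
      using \<alpha>(2) by (auto intro: less_imp_le)
    finally show "Inf ?S \<le> y" .
  qed
qed

subsection \<open>Limits superior of continuous functions\<close>

lemma open_eq_positive_set:
  fixes U :: "'a::metric_space set"
  assumes "open U"
  obtains g :: "'a \<Rightarrow> real" where "continuous_on UNIV g" "\<And>t. 0 < g t \<longleftrightarrow> t \<in> U"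
\<comment> \<open>The function is the distance to the complement. The whole space is separate
  because \<open>infdist\<close> to the empty set is 0.\<close>
proof (cases "U = UNIV")
  case True
  then show thesis
    by (intro that[of "\<lambda>_. 1"]) auto
next
  case False
  have "closed (- U)" "- U \<noteq> {}"
    using assms False by (auto simp: closed_def)
  then have "0 < infdist t (- U) \<longleftrightarrow> t \<in> U" for t
    using in_closed_iff_infdist_zero[of "- U" t] infdist_nonneg[of t "- U"] by auto
  then show thesis
    by (intro that[of "\<lambda>t. infdist t (- U)"] continuous_intros) auto
qed

text \<open>As \<open>m\<close> varies, the functions \<open>bump m\<close> localise \<open>1 / G\<close> near the integer
  \<open>m\<close>, written without a division so that they are continuous and vanish for \<open>G \<le> 0\<close>.\<close>

definition bump :: "nat \<Rightarrow> real \<Rightarrow> real" where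
  "bump m G = clamp01 ((real m + 1) * (2 * G - \<bar>1 - real m * G\<bar>))"

lemma bump_bounds: "0 \<le> bump m G" "bump m G \<le> 1"
  using clamp01_mem by (auto simp: bump_def)

lemma bump_posD:
  assumes "0 < bump m G"
  shows "0 < G" "real m * G < 1 + 2 * G"
proof -
  have "0 < (real m + 1) * (2 * G - \<bar>1 - real m * G\<bar>)"
    using assms by (auto simp: bump_def clamp01_def less_max_iff_disj)
  then have "\<bar>1 - real m * G\<bar> < 2 * G"
    by (simp add: zero_less_mult_iff)
  then show "0 < G" "real m * G < 1 + 2 * G"
    by linarith+
qed

text \<open>Positivity means that \<open>1 / G\<close> is within 2 of \<open>m\<close>, up to the
  case \<open>G \<le> 0\<close>, where every bump vanishes. A fixed point is therefore seen by
  finitely many \<open>m\<close> only.\<close>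

lemma finite_bump_pos: "finite {m. 0 < bump m G}"
proof (cases "0 < G")
  case True
  have "m \<le> nat \<lceil>(1 + 2 * G) / G\<rceil>" if "0 < bump m G" for m
  proof -
    have "real m < (1 + 2 * G) / G"
      using bump_posD(2)[OF that] True by (simp add: field_simps)
    then show ?thesis
      by linarith
  qed
  then show ?thesis
    by (intro finite_subset[OF _ finite_atMost[of "nat \<lceil>(1 + 2 * G) / G\<rceil>"]]) auto
next
  case False
  then have "{m. 0 < bump m G} = {}"
    using bump_posD(1) by blast
  then show ?thesis
    by simp
qed

text \<open>Take \<open>m\<close> to be the integer part of \<open>1 / G\<close>. Then
  \<open>0 \<le> 1 - m * G < G\<close>, so the bracket in \<open>bump\<close> is at least
  \<open>G\<close>, and the factor \<open>m + 1\<close> lifts it above 1.\<close>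

lemma ex_bump_eq_1:
  assumes "0 < G"
  shows "\<exists>m. bump m G = 1"
proof
  define m where "m = nat \<lfloor>1 / G\<rfloor>"
  have "real m \<le> 1 / G" "1 / G < real m + 1"
    using assms unfolding m_def by (simp_all add: of_nat_nat)
  then have m: "real m * G \<le> 1" "1 < (real m + 1) * G"
    using assms by (simp_all add: field_simps)
  then have "(real m + 1) * G \<le> (real m + 1) * (2 * G - \<bar>1 - real m * G\<bar>)"
    by (intro mult_left_mono) (auto simp: algebra_simps)
  with m(2) have "1 \<le> (real m + 1) * (2 * G - \<bar>1 - real m * G\<bar>)"
    by linarith
  then show "bump m G = 1"
    by (simp add: bump_def clamp01_def)
qed

lemma frequently_imp_le_limsup:
  fixes X :: "nat \<Rightarrow> ereal"
  assumes "\<And>N. \<exists>j\<ge>N. c \<le> X j"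
  shows "c \<le> limsup X"
proof (rule ccontr)
  assume "\<not> ?thesis"
  then have "\<forall>\<^sub>F j in sequentially. X j < c"
    by (intro Limsup_lessD) simp
  then show False
    using assms by (meson eventually_sequentially leD)
qed

text \<open>The open sets are first made monotone in \<open>q\<close>. A point then lies in the support of
  only finitely many of the functions whose height exceeds the given infimum.\<close>

lemma Inf_as_limsup_of_continuous:
  fixes q :: "nat \<Rightarrow> real" and U :: "nat \<Rightarrow> nat \<Rightarrow> 'a::metric_space set"
  assumes U: "\<And>i m. open (U i m)" and q: "\<And>i. 0 \<le> q i"
    and dense: "\<And>x y. \<lbrakk>0 \<le> x; x < y\<rbrakk> \<Longrightarrow> \<exists>i. x < q i \<and> q i < y"
  obtains B :: "nat \<Rightarrow> 'a \<Rightarrow> real" where "\<And>j. continuous_on UNIV (B j)"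
    "\<And>t. limsup (\<lambda>j. ereal (B j t)) = Inf {ereal (q i) |i. \<exists>m. t \<notin> U i m}"
proof -
  \<comment> \<open>Finite intersections, hence open. They shrink as \<open>n\<close> or
    \<open>q i\<close> grows, and membership for all \<open>n\<close> means that \<open>t\<close>
    lies in every \<open>U l m\<close> with \<open>q l \<le> q i\<close>.\<close>
  define W where "W i n = (\<Inter>l\<in>{l. l \<le> n \<and> q l \<le> q i}. \<Inter>m\<in>{..n}. U l m)" for i n
  have "open (W i n)" for i n
    unfolding W_def by (intro open_INT ballI U) auto
  then have "\<exists>g::'a \<Rightarrow> real. continuous_on UNIV g \<and> (\<forall>t. 0 < g t \<longleftrightarrow> t \<in> W i n)" for i n
    using open_eq_positive_set by metis
  then obtain G :: "nat \<Rightarrow> nat \<Rightarrow> 'a \<Rightarrow> real"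
    where G: "\<And>i n. continuous_on UNIV (G i n)" "\<And>i n t. 0 < G i n t \<longleftrightarrow> t \<in> W i n"
    by metis
  \<comment> \<open>Here \<open>i\<close> selects the value \<open>q i\<close>, \<open>n\<close> the
    stage of the intersection and \<open>m\<close> the bump. On \<open>W i n\<close> some
    \<open>m\<close> gives exactly \<open>q i\<close>, and the condition \<open>i \<le> n\<close>
    leaves finitely many \<open>i\<close> for each \<open>n\<close>.\<close>
  define height where "height i n m t = (if i \<le> n then q i * bump m (G i n t) else 0)" for i n m t
  define B where "B j = (case prod_decode j of (i, k) \<Rightarrow> case prod_decode k of (n, m) \<Rightarrow> height i n m)" for j
  have B_encode: "B (prod_encode (i, prod_encode (n, m))) = height i n m" for i n m
    by (simp add: B_def)
  have B_cases: "\<exists>i n m. j = prod_encode (i, prod_encode (n, m))" for j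
    by (metis prod.collapse prod_decode_inverse)
  show thesis
  proof (rule that)
    have "continuous_on UNIV (height i n m)" for i n m
      unfolding height_def bump_def by (cases "i \<le> n") (auto intro!: continuous_intros G(1))
    then show "continuous_on UNIV (B j)" for j
      using B_cases[of j] B_encode by auto
  next
    fix t
    let ?L = "limsup (\<lambda>j. ereal (B j t))" and ?S = "{ereal (q i) |i. \<exists>m. t \<notin> U i m}"
    show "?L = Inf ?S"
    proof (rule antisym)
      show "?L \<le> Inf ?S"
      proof (rule Inf_greatest, clarify)
        fix l0 m0 assume bad: "t \<notin> U l0 m0"
        define N where "N = max l0 m0"
        let ?T = "SIGMA i:{..<N}. SIGMA n:{..<N}. {m. 0 < bump m (G i n t)}"
        \<comment> \<open>Bumps are at most 1, so a value above \<open>q l0\<close> forces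
          \<open>q l0 \<le> q i\<close> and \<open>t \<in> W i n\<close>. For
          \<open>n \<ge> N\<close> that set is contained in \<open>U l0 m0\<close>, which misses
          \<open>t\<close>. Hence \<open>i \<le> n < N\<close>, and finitely many triples
          remain.\<close>
        have "{j. q l0 < B j t} \<subseteq> (\<lambda>(i, n, m). prod_encode (i, prod_encode (n, m))) ` ?T"
        proof
          fix j assume j: "j \<in> {j. q l0 < B j t}"
          obtain i n m where inm: "j = prod_encode (i, prod_encode (n, m))"
            using B_cases by blast
          then have h: "q l0 < height i n m t"
            using j B_encode by simp
          then have "i \<le> n"
            using q[of l0] by (auto simp: height_def split: if_splits)
          then have h': "q l0 < q i * bump m (G i n t)"
            using h by (simp add: height_def)
          then have "bump m (G i n t) \<noteq> 0"
            using q[of l0] by auto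
          then have pos: "0 < bump m (G i n t)"
            using bump_bounds(1)[of m "G i n t"] by simp
          have "q l0 \<le> q i"
            using h' bump_bounds q[of i] by (meson less_le_trans less_imp_le mult_left_le)
          moreover have "t \<in> W i n"
            using bump_posD(1)[OF pos] G(2) by blast
          ultimately have "\<not> (l0 \<le> n \<and> m0 \<le> n)"
            using bad by (auto simp: W_def)
          then have "n < N"
            by (auto simp: N_def)
          then have "(i, n, m) \<in> ?T"
            using \<open>i \<le> n\<close> pos by auto
          then show "j \<in> (\<lambda>(i, n, m). prod_encode (i, prod_encode (n, m))) ` ?T"
            unfolding inm by (auto intro!: image_eqI[of _ _ "(i, n, m)"])
        qed
        moreover have "finite ?T"
          by (intro finite_SigmaI finite_bump_pos) auto
        ultimately have "finite {j. q l0 < B j t}"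
          by (meson finite_imageI finite_subset)
        then have "\<forall>\<^sub>F j in sequentially. ereal (B j t) \<le> ereal (q l0)"
          by (simp add: cofinite_eq_sequentially[symmetric] eventually_cofinite not_le)
        then show "?L \<le> ereal (q l0)"
          by (rule Limsup_bounded)
      qed
      show "Inf ?S \<le> ?L"
      proof (rule dense_le)
        fix y assume y: "y < Inf ?S"
        \<comment> \<open>The values \<open>q i\<close> are dense only above 0; smaller
          \<open>y\<close> are handled by nonnegativity of the heights.\<close>
        have "0 \<le> B j t" for j
          using B_cases[of j] B_encode q bump_bounds(1) by (auto simp: height_def)
        then have L0: "0 \<le> ?L"
          by (intro frequently_imp_le_limsup) auto
        show "y \<le> ?L"
        proof (cases "y \<le> 0")
          case True
          then show ?thesis
            using L0 by (rule order.trans)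
        next
          case False
          obtain x where x: "y < ereal x" "ereal x < Inf ?S"
            using ereal_dense2[OF y] by blast
          obtain x' where x': "ereal x < ereal x'" "ereal x' < Inf ?S"
            using ereal_dense2[OF x(2)] by blast
          have "0 < ereal x"
            using False x(1) less_trans[of 0 y "ereal x"] by (simp add: not_le)
          then obtain i where i: "x < q i" "q i < x'"
            using dense[of x x'] x'(1) by auto
          have good: "t \<in> U l m" if "q l \<le> q i" for l m
          proof (rule ccontr)
            assume "t \<notin> U l m"
            then have "Inf ?S \<le> ereal (q l)"
              by (intro Inf_lower) auto
            also have "\<dots> \<le> ereal x'"
              using that i by simp
            finally show False
              using x'(2) by simp
          qed
          \<comment> \<open>At each stage \<open>n\<close> some bump equals 1 at \<open>t\<close>.
            The pair encoding dominates its components, so these indices are at least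
            \<open>n\<close> and exceed any given \<open>N\<close>.\<close>
          have "ereal (q i) \<le> ?L"
          proof (rule frequently_imp_le_limsup)
            fix N
            define n where "n = max N i"
            have "0 < G i n t"
              using good by (auto simp: G(2) W_def)
            then obtain m where "bump m (G i n t) = 1"
              using ex_bump_eq_1 by blast
            then have "height i n m t = q i"
              by (simp add: height_def n_def)
            moreover have "N \<le> prod_encode (i, prod_encode (n, m))"
              using le_prod_encode_1[of n m] le_prod_encode_2[of "prod_encode (n, m)" i]
              by (auto simp: n_def)
            ultimately show "\<exists>j\<ge>N. ereal (q i) \<le> ereal (B j t)"
              using B_encode by (metis order.refl)
          qed
          moreover have "y < ereal (q i)"
            using x(1) i(1) less_trans[of y "ereal x" "ereal (q i)"] by simp
          ultimately show ?thesis
            by simp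
        qed
      qed
    qed
  qed
qed

section \<open>Limits of interleaved sequences\<close>

lemma limsup_interleave:
  fixes X Y :: "nat \<Rightarrow> ereal"
  shows "limsup (\<lambda>j. if even j then X (j div 2) else Y (j div 2)) = max (limsup X) (limsup Y)"
    (is "limsup ?Z = _")
proof (rule antisym)
  show "limsup ?Z \<le> max (limsup X) (limsup Y)"
  proof (rule dense_ge)
    fix c assume c: "max (limsup X) (limsup Y) < c"
    have "filterlim (\<lambda>j::nat. j div 2) sequentially sequentially"
      unfolding filterlim_at_top
    proof
      fix Z :: nat
      show "\<forall>\<^sub>F j in sequentially. Z \<le> j div 2"
        by (rule eventually_sequentiallyI[of "2 * Z"]) simp
    qed
    moreover have "\<forall>\<^sub>F j in sequentially. X j < c \<and> Y j < c"
      using c Limsup_lessD[of sequentially X c] Limsup_lessD[of sequentially Y c]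
      by (simp add: eventually_conj_iff)
    ultimately have "\<forall>\<^sub>F j in sequentially. X (j div 2) < c \<and> Y (j div 2) < c"
      by (rule filterlim_iff[THEN iffD1, rule_format])
    then have "\<forall>\<^sub>F j in sequentially. ?Z j \<le> c"
      by eventually_elim auto
    then show "limsup ?Z \<le> c"
      by (rule Limsup_bounded)
  qed
  have "limsup (?Z \<circ> (\<lambda>j. 2 * j)) \<le> limsup ?Z" "limsup (?Z \<circ> (\<lambda>j. 2 * j + 1)) \<le> limsup ?Z"
    by (intro limsup_subseq_mono strict_monoI; simp)+
  then show "max (limsup X) (limsup Y) \<le> limsup ?Z"
    by (simp add: comp_def)
qed

lemma liminf_interleave:
  fixes X Y :: "nat \<Rightarrow> ereal"
  shows "liminf (\<lambda>j. if even j then X (j div 2) else Y (j div 2)) = min (liminf X) (liminf Y)"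
    (is "liminf ?Z = _")
proof -
  have minus: "liminf V = - limsup (\<lambda>j. - V j)" for V :: "nat \<Rightarrow> ereal"
    using ereal_Limsup_uminus[of sequentially V] by simp
  have "(\<lambda>j. - ?Z j) = (\<lambda>j. if even j then - X (j div 2) else - Y (j div 2))"
    by auto
  then have "liminf ?Z = - max (limsup (\<lambda>j. - X j)) (limsup (\<lambda>j. - Y j))"
    unfolding minus[of ?Z] using limsup_interleave[of "\<lambda>j. - X j" "\<lambda>j. - Y j"] by simp
  then show ?thesis
    unfolding minus[of X] minus[of Y]
    by (cases "limsup (\<lambda>j. - X j)"; cases "limsup (\<lambda>j. - Y j)")
       (auto simp: max_def min_def)
qed

subsection \<open>Exponents of a nowhere differentiable function\<close>

text \<open>Admissible orders can be increased slightly to rational ones, so countably many suffice.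
  The sets \<open>U i m\<close> are chosen so that \<open>t\<close> is missing from one of them
  exactly when the limit superior of the exponents \<open>X i t\<close> is strictly below
  \<open>q i\<close>; the term \<open>1 / (m + 1)\<close> makes it strict.\<close>

lemma upper_hoelder_exponent_as_limsup:
  assumes f: "continuous_on {0..1} f"
  obtains B :: "nat \<Rightarrow> real \<Rightarrow> real" where "\<And>j. continuous_on UNIV (B j)"
    "\<And>t. t \<in> {0..1} \<Longrightarrow> limsup (\<lambda>j. ereal (B j t)) = upper_hoelder_exponent {0..1} f t"
proof -
  define q :: "nat \<Rightarrow> real" where "q i = max 0 (of_rat (from_nat i))" for i
  define X where "X i t j = local_exponent (nat \<lfloor>q i\<rfloor> + 1) f t j" for i t j
  define U where "U i m = {t. \<exists>j\<ge>m. q i - 1 / (real m + 1) < X i t j}" for i m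
  have q: "0 \<le> q i" for i
    by (simp add: q_def)
  have dense: "\<exists>i. x < q i \<and> q i < y" if xy: "0 \<le> x" "x < y" for x y
  proof -
    obtain p where "x < of_rat p" "of_rat p < y"
      using of_rat_dense[OF xy(2)] by blast
    then show ?thesis
      using xy(1) by (intro exI[of _ "to_nat p"]) (auto simp: q_def)
  qed
  have open_U: "open (U i m)" for i m
  proof -
    have "U i m = (\<Union>j\<in>{m..}. {t. q i - 1 / (real m + 1) < X i t j})"
      by (auto simp: U_def)
    moreover have "open {t. q i - 1 / (real m + 1) < X i t j}" for j
      unfolding X_def by (intro open_Collect_less continuous_on_const continuous_on_local_exponent f) auto
    ultimately show ?thesis
      by auto
  qed
  have Inf_eq: "Inf {ereal (q i) |i. \<exists>m. t \<notin> U i m} = upper_hoelder_exponent {0..1} f t" if t: "t \<in> {0..1}" for t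
    unfolding upper_hoelder_exponent_def
  proof (rule antisym)
    show "Inf {ereal (q i) |i. \<exists>m. t \<notin> U i m} \<le> Inf {ereal \<alpha> |\<alpha>. 0 \<le> \<alpha> \<and> irregular_at {0..1} \<alpha> f t}"
    proof (rule Inf_greatest, clarify)
      fix \<alpha> :: real assume \<alpha>: "0 \<le> \<alpha>" "irregular_at {0..1} \<alpha> f t"
      show "Inf {ereal (q i) |i. \<exists>m. t \<notin> U i m} \<le> ereal \<alpha>"
      proof (rule dense_ge)
        fix y assume "ereal \<alpha> < y"
        \<comment> \<open>Staying below \<open>\<lfloor>\<alpha>\<rfloor> + 1\<close> preserves the
          integer part, and with it the order of the differences, when \<open>\<alpha>\<close> is
          replaced by \<open>q i\<close>.\<close>
        then have "ereal \<alpha> < min y (ereal (of_int \<lfloor>\<alpha>\<rfloor> + 1))"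
          by simp
        then obtain y' where y': "ereal \<alpha> < ereal y'" "ereal y' < min y (ereal (of_int \<lfloor>\<alpha>\<rfloor> + 1))"
          using ereal_dense2 by blast
        then obtain i where i: "\<alpha> < q i" "q i < y'"
          using dense \<alpha>(1) by auto
        have "\<lfloor>q i\<rfloor> = \<lfloor>\<alpha>\<rfloor>"
          using i y'(2) by (simp add: floor_eq_iff) linarith
        then have "limsup (\<lambda>j. ereal (X i t j)) \<le> ereal \<alpha>"
          using irregular_at_imp_limsup_le[OF f \<alpha>(2)] by (simp add: X_def)
        also have "\<dots> < ereal ((\<alpha> + q i) / 2)"
          using i by simp
        finally have "\<forall>\<^sub>F j in sequentially. ereal (X i t j) < ereal ((\<alpha> + q i) / 2)"
          by (rule Limsup_lessD)
        then obtain k where k: "\<And>j. j \<ge> k \<Longrightarrow> X i t j < (\<alpha> + q i) / 2"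
          by (auto simp: eventually_sequentially)
        \<comment> \<open>Beyond \<open>k\<close> the exponents are below the midpoint of
          \<open>\<alpha>\<close> and \<open>q i\<close>; \<open>k'\<close> makes
          \<open>1 / (m + 1)\<close> smaller than half their distance, so
          \<open>m = max k k'\<close> is a witness.\<close>
        obtain k' :: nat where "2 / (q i - \<alpha>) < real k'"
          using reals_Archimedean2 by blast
        then have "2 / (q i - \<alpha>) < real (max k k') + 1"
          by linarith
        then have "1 / (real (max k k') + 1) < (q i - \<alpha>) / 2"
          using i(1) by (simp add: field_simps)
        then have "(\<alpha> + q i) / 2 \<le> q i - 1 / (real (max k k') + 1)"
          by (simp add: field_simps)
        then have "t \<notin> U i (max k k')"
          using k by (fastforce simp: U_def)
        then have "Inf {ereal (q i) |i. \<exists>m. t \<notin> U i m} \<le> ereal (q i)"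
          by (intro Inf_lower) auto
        also have "\<dots> \<le> y"
          using i(2) y'(2) by (metis ereal_less_eq(3) less_imp_le min_less_iff_conj order.trans)
        finally show "Inf {ereal (q i) |i. \<exists>m. t \<notin> U i m} \<le> y" .
      qed
    qed
    show "Inf {ereal \<alpha> |\<alpha>. 0 \<le> \<alpha> \<and> irregular_at {0..1} \<alpha> f t} \<le> Inf {ereal (q i) |i. \<exists>m. t \<notin> U i m}"
    proof (rule Inf_greatest, clarify)
      fix i m assume "t \<notin> U i m"
      then have "\<forall>\<^sub>F j in sequentially. ereal (X i t j) \<le> ereal (q i - 1 / (real m + 1))"
        by (intro eventually_sequentiallyI[of m]) (auto simp: U_def not_less)
      then have "limsup (\<lambda>j. ereal (X i t j)) \<le> ereal (q i - 1 / (real m + 1))"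
        by (rule Limsup_bounded)
      also have "\<dots> < ereal (q i)"
        by simp
      finally have "irregular_at {0..1} (q i) f t"
        unfolding X_def by (rule limsup_less_imp_irregular_at[OF f t q])
      then show "Inf {ereal \<alpha> |\<alpha>. 0 \<le> \<alpha> \<and> irregular_at {0..1} \<alpha> f t} \<le> ereal (q i)"
        using q by (intro Inf_lower) auto
    qed
  qed
  show thesis
  proof (rule Inf_as_limsup_of_continuous[of U q, OF open_U q dense])
    fix B :: "nat \<Rightarrow> real \<Rightarrow> real"
    assume "\<And>j. continuous_on UNIV (B j)"
      and "\<And>t. limsup (\<lambda>j. ereal (B j t)) = Inf {ereal (q i) |i. \<exists>m. t \<notin> U i m}"
    with Inf_eq show thesis
      by (intro that[of B]) auto
  qed
qed

theorem exponents_of_nowhere_differentiable: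
  assumes f: "continuous_on {0..1} f"
    and nd: "\<And>t. t \<in> {0..1} \<Longrightarrow> \<not> f differentiable (at t within {0..1})"
  shows "\<exists>H :: nat \<Rightarrow> real \<Rightarrow> real. (\<forall>j. continuous_on {0..1} (H j)) \<and>
    (\<forall>t\<in>{0..1}. lower_hoelder_exponent {0..1} f t = liminf (\<lambda>j. ereal (H j t)) \<and>
                upper_hoelder_exponent {0..1} f t = limsup (\<lambda>j. ereal (H j t)))"
proof -
  obtain B :: "nat \<Rightarrow> real \<Rightarrow> real" where B: "\<And>j. continuous_on UNIV (B j)"
    "\<And>t. t \<in> {0..1} \<Longrightarrow> limsup (\<lambda>j. ereal (B j t)) = upper_hoelder_exponent {0..1} f t"
    using upper_hoelder_exponent_as_limsup[OF f] by metis
  \<comment> \<open>Capping at 1 leaves the limit inferior unchanged, as it is at most 1. It also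
    keeps the limit superior below the upper exponent: irregularity of order at least 1 concerns
    higher differences and says nothing about first ones.\<close>
  define A where "A j t = min 1 (local_exponent 1 f t j)" for j t
  \<comment> \<open>The maximum with \<open>A\<close> prevents \<open>B\<close>, of which only the
    limit superior is known, from lowering the limit inferior.\<close>
  define H where "H j t = (if even j then A (j div 2) t else max (A (j div 2) t) (B (j div 2) t))" for j t
  have "continuous_on UNIV (A j)" for j
    unfolding A_def by (intro continuous_intros continuous_on_local_exponent f) auto
  then have "continuous_on UNIV (H j)" for j
    unfolding H_def by (cases "even j") (auto intro!: continuous_intros B)
  then have cont: "continuous_on {0..1} (H j)" for j
    by (rule continuous_on_subset) auto
  have "lower_hoelder_exponent {0..1} f t = liminf (\<lambda>j. ereal (H j t)) \<and>
    upper_hoelder_exponent {0..1} f t = limsup (\<lambda>j. ereal (H j t))" if t: "t \<in> {0..1}" for t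
  proof
    let ?A = "\<lambda>j. ereal (A j t)" and ?M = "\<lambda>j. ereal (max (A j t) (B j t))"
    let ?L = "\<lambda>j. ereal (local_exponent 1 f t j)" and ?v = "upper_hoelder_exponent {0..1} f t"
    have H_eq: "(\<lambda>j. ereal (H j t)) = (\<lambda>j. if even j then ?A (j div 2) else ?M (j div 2))"
      by (auto simp: H_def)
    have "liminf ?A = liminf ?L"
    proof (rule antisym)
      show "liminf ?A \<le> liminf ?L"
        by (intro Liminf_mono always_eventually) (auto simp: A_def)
      show "liminf ?L \<le> liminf ?A"
        unfolding le_Liminf_iff
      proof (intro allI impI)
        fix y assume y: "y < liminf ?L"
        then have "y < 1"
          using liminf_local_exponent_le_1[OF f t nd[OF t]] by (rule less_le_trans)
        from less_LiminfD[OF y] show "\<forall>\<^sub>F j in sequentially. y < ?A j"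
          by eventually_elim (use \<open>y < 1\<close> in \<open>auto simp: A_def min_def one_ereal_def\<close>)
      qed
    qed
    moreover have "liminf ?A \<le> liminf ?M"
      by (intro Liminf_mono always_eventually) auto
    ultimately show "lower_hoelder_exponent {0..1} f t = liminf (\<lambda>j. ereal (H j t))"
      unfolding H_eq liminf_interleave[of ?A ?M] lower_hoelder_exponent_eq_liminf[OF f t nd[OF t]]
      by (simp add: min_def)
    have A_le: "limsup ?A \<le> ?v"
      unfolding upper_hoelder_exponent_def
    proof (rule Inf_greatest, clarify)
      fix \<alpha> :: real assume \<alpha>: "0 \<le> \<alpha>" "irregular_at {0..1} \<alpha> f t"
      show "limsup ?A \<le> ereal \<alpha>"
      proof (cases "\<alpha> < 1")
        case True
        then have "nat \<lfloor>\<alpha>\<rfloor> + 1 = 1"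
          using \<alpha>(1) by linarith
        then have "limsup ?L \<le> ereal \<alpha>"
          using irregular_at_imp_limsup_le[OF f \<alpha>(2)] by simp
        moreover have "limsup ?A \<le> limsup ?L"
          by (intro Limsup_mono always_eventually) (auto simp: A_def)
        ultimately show ?thesis
          by (rule order.trans[rotated])
      next
        case False
        then show ?thesis
          by (intro Limsup_bounded always_eventually) (auto simp: A_def min_le_iff_disj simp flip: ereal_min)
      qed
    qed
    have "limsup ?M = ?v"
    proof (rule antisym)
      show "limsup ?M \<le> ?v"
      proof (rule dense_ge)
        fix c assume c: "?v < c"
        have "\<forall>\<^sub>F j in sequentially. ?A j < c" "\<forall>\<^sub>F j in sequentially. ereal (B j t) < c"
          using c A_le B(2)[OF t] by (auto intro!: Limsup_lessD)
        then have "\<forall>\<^sub>F j in sequentially. ?M j \<le> c"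
          by eventually_elim (auto simp: max_def)
        then show "limsup ?M \<le> c"
          by (rule Limsup_bounded)
      qed
      show "?v \<le> limsup ?M"
        unfolding B(2)[OF t, symmetric] by (intro Limsup_mono always_eventually) auto
    qed
    then show "?v = limsup (\<lambda>j. ereal (H j t))"
      unfolding H_eq limsup_interleave[of ?A ?M] using A_le by (simp add: max_def)
  qed
  with cont show ?thesis
    by blast
qed

subsection \<open>Averages over rapidly growing blocks\<close>

lemma limsup_liminf_cong:
  fixes X Y :: "nat \<Rightarrow> real"
  assumes "(\<lambda>j. X j - Y j) \<longlonglongrightarrow> 0"
  shows "limsup (\<lambda>j. ereal (X j)) = limsup (\<lambda>j. ereal (Y j))"
    and "liminf (\<lambda>j. ereal (X j)) = liminf (\<lambda>j. ereal (Y j))"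
proof -
  have "(\<lambda>j. ereal (X j - Y j)) \<longlonglongrightarrow> 0"
    using assms by (simp add: zero_ereal_def)
  from ereal_limsup_lim_add[OF this, of "\<lambda>j. ereal (Y j)"] ereal_liminf_lim_add[OF this, of "\<lambda>j. ereal (Y j)"]
  show "limsup (\<lambda>j. ereal (X j)) = limsup (\<lambda>j. ereal (Y j))"
    and "liminf (\<lambda>j. ereal (X j)) = liminf (\<lambda>j. ereal (Y j))"
    by simp_all
qed

text \<open>Eventually all terms are below \<open>c\<close>. The finitely many others contribute at
  most the fixed amount \<open>K\<close>, which division by \<open>J\<close> makes smaller than the
  margin \<open>c' - c\<close>.\<close>

lemma limsup_average_le:
  fixes s :: "nat \<Rightarrow> real"
  shows "limsup (\<lambda>J. ereal ((\<Sum>l<J. s l) / real J)) \<le> limsup (\<lambda>l. ereal (s l))"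
proof (rule dense_ge)
  fix y assume "limsup (\<lambda>l. ereal (s l)) < y"
  then obtain c' where c': "limsup (\<lambda>l. ereal (s l)) < ereal c'" "ereal c' < y"
    using ereal_dense2 by blast
  obtain c where c: "limsup (\<lambda>l. ereal (s l)) < ereal c" "ereal c < ereal c'"
    using ereal_dense2[OF c'(1)] by blast
  have "\<forall>\<^sub>F l in sequentially. ereal (s l) < ereal c"
    using c(1) by (rule Limsup_lessD)
  then obtain k where k: "\<And>l. l \<ge> k \<Longrightarrow> s l < c"
    by (auto simp: eventually_sequentially)
  define K where "K = (\<Sum>l<k. \<bar>s l - c\<bar>)"
  have "(\<lambda>J. K / real J) \<longlonglongrightarrow> 0"
    by (rule lim_const_over_n)
  then have "\<forall>\<^sub>F J in sequentially. K / real J < c' - c"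
    using c(2) by (intro order_tendstoD) auto
  then have "\<forall>\<^sub>F J in sequentially. ereal ((\<Sum>l<J. s l) / real J) \<le> ereal c'"
    using eventually_ge_at_top[of "max 1 k"]
  proof eventually_elim
    case (elim J)
    have "(\<Sum>l<J. s l - c) \<le> (\<Sum>l<J. if l < k then \<bar>s l - c\<bar> else 0)"
      by (intro sum_mono) (use k in \<open>auto simp: not_less less_imp_le\<close>)
    also have "\<dots> = K"
      unfolding K_def using elim(2) by (intro sum.mono_neutral_cong_right) auto
    finally have "(\<Sum>l<J. s l) \<le> c * real J + K"
      by (simp add: sum_subtractf mult.commute)
    then have "(\<Sum>l<J. s l) / real J \<le> c + K / real J"
      using elim(2) by (simp add: field_simps)
    then show ?case
      using elim(1) by simp
  qed
  then have "limsup (\<lambda>J. ereal ((\<Sum>l<J. s l) / real J)) \<le> ereal c'"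
    by (rule Limsup_bounded)
  also have "\<dots> \<le> y"
    using c'(2) by (rule less_imp_le)
  finally show "limsup (\<lambda>J. ereal ((\<Sum>l<J. s l) / real J)) \<le> y" .
qed

text \<open>Block \<open>i\<close> runs from \<open>block_start M i\<close> to just before
  \<open>block_start M (Suc i)\<close>. The summand \<open>M (Suc i)\<close> delays the next index
  to a prescribed level, and the multiple \<open>(i + 1)\<close> makes everything before block
  \<open>i\<close> a fraction of at most \<open>1 / (i + 1)\<close> of the levels up to its
  end.\<close>

primrec block_start :: "(nat \<Rightarrow> nat) \<Rightarrow> nat \<Rightarrow> nat" where
  "block_start M 0 = 0"
| "block_start M (Suc i) = M (Suc i) + (i + 1) * block_start M i + block_start M i + 1"

definition block_index :: "(nat \<Rightarrow> nat) \<Rightarrow> nat \<Rightarrow> nat" where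
  "block_index M l = (LEAST i. l < block_start M (Suc i))"

lemma strict_mono_block_start: "strict_mono (block_start M)"
  by (rule strict_monoI_Suc) simp

lemma block_index_bounds:
  "block_start M (block_index M l) \<le> l" "l < block_start M (Suc (block_index M l))"
proof -
  have "l < block_start M (Suc l)"
    using strict_mono_imp_increasing[OF strict_mono_block_start[of M], of "Suc l"] by linarith
  then show "l < block_start M (Suc (block_index M l))"
    unfolding block_index_def by (rule LeastI)
  show "block_start M (block_index M l) \<le> l"
  proof (cases "block_index M l")
    case (Suc i)
    then have "\<not> l < block_start M (Suc i)"
      unfolding block_index_def by (intro not_less_Least) simp
    then show ?thesis
      by (simp only: Suc not_less)
  qed simp
qed

lemma block_index_eqI:
  assumes "block_start M i \<le> l" "l < block_start M (Suc i)"
  shows "block_index M l = i"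
proof -
  have "block_start M i < block_start M (Suc (block_index M l))"
    "block_start M (block_index M l) < block_start M (Suc i)"
    using assms block_index_bounds[where M = M and l = l] by linarith+
  then show ?thesis
    by (simp only: strict_mono_less[OF strict_mono_block_start])
qed

lemma le_block_index:
  assumes "block_start M i \<le> l"
  shows "i \<le> block_index M l"
proof -
  have "block_start M i < block_start M (Suc (block_index M l))"
    using assms block_index_bounds(2)[of l M] by linarith
  then show ?thesis
    by (simp only: strict_mono_less[OF strict_mono_block_start] less_Suc_eq_le)
qed

lemma filterlim_block_index: "filterlim (block_index M) sequentially sequentially"
  unfolding filterlim_at_top
proof
  fix i show "\<forall>\<^sub>F l in sequentially. i \<le> block_index M l"
    by (rule eventually_sequentiallyI[of "block_start M i"]) (rule le_block_index)
qed

text \<open>An index is used only from its prescribed level on. Block 0 begins at level 0, so its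
  delay has to be 0.\<close>

lemma block_index_delay:
  assumes "M 0 = 0"
  shows "M (block_index M l) \<le> l"
proof -
  have "M i \<le> block_start M i" for i
    using assms by (cases i) auto
  then show ?thesis
    by (rule order.trans) (rule block_index_bounds(1))
qed

text \<open>One inequality is averaging. For the other, at the end of block \<open>i\<close> only
  the levels below \<open>N i\<close> carry values different from \<open>h i\<close>, each off by at
  most 2, so the average is within \<open>2 / (i + 1)\<close> of \<open>h i\<close>.\<close>

lemma limsup_block_average:
  fixes h :: "nat \<Rightarrow> real"
  assumes h: "\<And>i. \<bar>h i\<bar> \<le> 1"
  shows "limsup (\<lambda>J. ereal ((\<Sum>l<J. h (block_index M l)) / real J)) = limsup (\<lambda>i. ereal (h i))"
    (is "limsup ?A = _")
proof (rule antisym)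
  have "limsup ?A \<le> limsup (\<lambda>l. ereal (h (block_index M l)))"
    by (rule limsup_average_le)
  also have "\<dots> \<le> limsup (\<lambda>i. ereal (h i))"
  proof (rule dense_ge)
    fix y assume "limsup (\<lambda>i. ereal (h i)) < y"
    then have "\<forall>\<^sub>F i in sequentially. ereal (h i) < y"
      by (rule Limsup_lessD)
    then have "\<forall>\<^sub>F l in sequentially. ereal (h (block_index M l)) < y"
      using filterlim_block_index by (rule eventually_compose_filterlim)
    then show "limsup (\<lambda>l. ereal (h (block_index M l))) \<le> y"
      by (intro Limsup_bounded) (auto elim: eventually_mono)
  qed
  finally show "limsup ?A \<le> limsup (\<lambda>i. ereal (h i))" .
  define N where "N = block_start M"
  have "\<bar>(\<Sum>l<N (Suc i). h (block_index M l)) / real (N (Suc i)) - h i\<bar> \<le> 2 / real (Suc i)" for i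
  proof -
    have N: "0 < N (Suc i)" "(i + 1) * N i \<le> N (Suc i)"
      by (simp_all add: N_def)
    have "(\<Sum>l<N (Suc i). h (block_index M l)) / real (N (Suc i)) - h i
        = (\<Sum>l<N (Suc i). h (block_index M l) - h i) / real (N (Suc i))"
      using N(1) by (simp add: sum_subtractf field_simps)
    also have "(\<Sum>l<N (Suc i). h (block_index M l) - h i) = (\<Sum>l<N i. h (block_index M l) - h i)"
    proof (rule sum.mono_neutral_right)
      show "{..<N i} \<subseteq> {..<N (Suc i)}"
        by (auto simp: N_def)
      show "\<forall>l\<in>{..<N (Suc i)} - {..<N i}. h (block_index M l) - h i = 0"
        using block_index_eqI[of M i] by (auto simp: N_def simp del: block_start.simps)
    qed simp
    finally have eq: "(\<Sum>l<N (Suc i). h (block_index M l)) / real (N (Suc i)) - h i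
        = (\<Sum>l<N i. h (block_index M l) - h i) / real (N (Suc i))" .
    have "\<bar>\<Sum>l<N i. h (block_index M l) - h i\<bar> \<le> (\<Sum>l<N i. 2)"
    proof (rule order.trans[OF sum_abs sum_mono])
      fix l show "\<bar>h (block_index M l) - h i\<bar> \<le> 2"
        using h[of "block_index M l"] h[of i] by linarith
    qed
    also have "\<dots> = 2 * real (N i)"
      by simp
    finally have "\<bar>\<Sum>l<N i. h (block_index M l) - h i\<bar> / real (N (Suc i)) \<le> 2 * real (N i) / real (N (Suc i))"
      by (intro divide_right_mono) auto
    also have "\<dots> \<le> 2 / real (Suc i)"
    proof -
      have "real ((i + 1) * N i) \<le> real (N (Suc i))"
        using N(2) by (simp only: of_nat_le_iff)
      then show ?thesis
        using N(1) by (simp add: field_simps)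
    qed
    finally show ?thesis
      unfolding eq by simp
  qed
  then have "\<forall>\<^sub>F i in sequentially.
      norm ((\<Sum>l<N (Suc i). h (block_index M l)) / real (N (Suc i)) - h i) \<le> 2 / real (Suc i)"
    by (intro always_eventually allI) simp
  moreover have "(\<lambda>i. 2 / real (Suc i)) \<longlonglongrightarrow> 0"
    by (rule LIMSEQ_Suc[OF lim_const_over_n])
  ultimately have "(\<lambda>i. (\<Sum>l<N (Suc i). h (block_index M l)) / real (N (Suc i)) - h i) \<longlonglongrightarrow> 0"
    by (rule Lim_null_comparison)
  from limsup_liminf_cong(1)[OF this]
  have "limsup (\<lambda>i. ereal (h i)) = limsup (?A \<circ> (\<lambda>i. N (Suc i)))"
    by (simp add: comp_def)
  also have "\<dots> \<le> limsup ?A"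
    by (intro limsup_subseq_mono strict_monoI)
       (simp add: N_def strict_mono_less[OF strict_mono_block_start] del: block_start.simps)
  finally show "limsup (\<lambda>i. ereal (h i)) \<le> limsup ?A" .
qed

lemma liminf_block_average:
  fixes h :: "nat \<Rightarrow> real"
  assumes "\<And>i. \<bar>h i\<bar> \<le> 1"
  shows "liminf (\<lambda>J. ereal ((\<Sum>l<J. h (block_index M l)) / real J)) = liminf (\<lambda>i. ereal (h i))"
proof -
  have minus: "liminf (\<lambda>j. ereal (V j)) = - limsup (\<lambda>j. ereal (- V j))" for V :: "nat \<Rightarrow> real"
    using ereal_Limsup_uminus[of sequentially "\<lambda>j. ereal (V j)"] by simp
  show ?thesis
    unfolding minus using limsup_block_average[of "\<lambda>i. - h i" M] assms
    by (simp add: sum_negf)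
qed

subsection \<open>The distance to the nearest integer\<close>

definition triangle :: "real \<Rightarrow> real" where
  "triangle y = \<bar>y - of_int (round y)\<bar>"

lemma triangle_nonneg: "0 \<le> triangle y"
  by (simp add: triangle_def)

lemma triangle_le_half: "triangle y \<le> 1 / 2"
  unfolding triangle_def using of_int_round_abs_le[of y] by (simp add: abs_minus_commute)

lemma triangle_le: "triangle y \<le> \<bar>y - of_int n\<bar>"
  unfolding triangle_def using round_diff_minimal[of y n] by simp

lemma triangle_of_int [simp]: "triangle (of_int n) = 0"
  by (simp add: triangle_def)

lemma triangle_nonexpansive: "\<bar>triangle x - triangle y\<bar> \<le> \<bar>x - y\<bar>"
  using triangle_le[of x "round y"] triangle_le[of y "round x"]
  unfolding triangle_def by linarith

lemma triangle_even:
  assumes "of_int n \<le> y" "y \<le> of_int n + 1 / 2"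
  shows "triangle y = y - of_int n"
proof (rule antisym)
  show "triangle y \<le> y - of_int n"
    using triangle_le[of y n] assms by simp
  have "round y \<le> n \<or> n + 1 \<le> round y"
    by linarith
  then have "of_int (round y) \<le> (of_int n :: real) \<or> of_int n + 1 \<le> (of_int (round y) :: real)"
    by (metis of_int_1 of_int_add of_int_le_iff)
  then show "y - of_int n \<le> triangle y"
    unfolding triangle_def using assms by linarith
qed

lemma triangle_odd:
  assumes "of_int n - 1 / 2 \<le> y" "y \<le> of_int n"
  shows "triangle y = of_int n - y"
proof (rule antisym)
  show "triangle y \<le> of_int n - y"
    using triangle_le[of y n] assms by simp
  have "round y \<le> n - 1 \<or> n \<le> round y"
    by linarith
  then have "of_int (round y) \<le> (of_int n - 1 :: real) \<or> of_int n \<le> (of_int (round y) :: real)"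
    by (metis of_int_1 of_int_diff of_int_le_iff)
  then show "of_int n - y \<le> triangle y"
    unfolding triangle_def using assms by linarith
qed

subsection \<open>A lacunary series with slowly varying exponents\<close>

text \<open>The increments \<open>g l\<close> are the exponents at level \<open>l\<close>, and
  \<open>e l\<close> bounds their oscillation at scale \<open>2 ^ - l\<close>. Vanishing averages of
  \<open>e\<close> make the partial sums vary by \<open>o(J)\<close> at scale \<open>J\<close>. The
  factor 4 leaves room for rounding points to dyadic ones.\<close>

locale slow_exponents =
  fixes g :: "nat \<Rightarrow> real \<Rightarrow> real" and a b :: real and e :: "nat \<Rightarrow> real"
  assumes a: "0 < a" and b: "b < 1"
    and g_bounds: "\<And>l x. a \<le> g l x" "\<And>l x. g l x \<le> b"
    and e_bounds: "\<And>l. 0 \<le> e l" "\<And>l. e l \<le> 1"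
    and g_osc: "\<And>l x y. \<bar>x - y\<bar> \<le> 4 / 2 ^ l \<Longrightarrow> \<bar>g l x - g l y\<bar> \<le> e l"
    and e_average: "(\<lambda>J. (\<Sum>l<J. e l) / real J) \<longlonglongrightarrow> 0"
begin

definition S :: "nat \<Rightarrow> real \<Rightarrow> real" where
  "S J x = (\<Sum>l<J. g l x)"

definition E :: "nat \<Rightarrow> real" where
  "E J = (\<Sum>l<J. e l)"

text \<open>The amplitude is constant on each dyadic interval of length \<open>2\<^sup>-\<^sup>l\<close>, so that
  each term is affine on both halves of it.\<close>

definition wave :: "nat \<Rightarrow> real \<Rightarrow> real" where
  "wave l x = 2 powr - S l (of_int \<lfloor>2 ^ l * x\<rfloor> / 2 ^ l) * triangle (2 ^ l * x)"

definition F :: "real \<Rightarrow> real" where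
  "F x = (\<Sum>l. wave l x)"

text \<open>A common decay rate on both sides of level \<open>J\<close>: finer amplitudes shrink at
  rate \<open>a\<close> per level, while the slopes of coarser terms shrink at rate
  \<open>1 - b\<close>.\<close>

definition \<delta> :: real where
  "\<delta> = min a (1 - b)"

definition \<sigma> :: real where
  "\<sigma> = 2 powr - \<delta>"

lemma \<sigma>_bounds: "0 < \<sigma>" "\<sigma> < 1"
proof -
  have "0 < \<delta>"
    using a b by (simp add: \<delta>_def)
  then show "0 < \<sigma>" "\<sigma> < 1"
    using powr_less_mono[of "- \<delta>" 0 2] by (simp_all add: \<sigma>_def)
qed

lemma \<sigma>_power: "\<sigma> ^ k = 2 powr - (\<delta> * real k)"
  by (simp add: \<sigma>_def powr_power mult.commute)

lemma E_mono: "J \<le> l \<Longrightarrow> E J \<le> E l"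
  unfolding E_def using e_bounds by (intro sum_mono2) auto

lemma E_le: "E J \<le> real J"
  unfolding E_def using sum_mono[of "{..<J}" e "\<lambda>_. 1"] e_bounds by simp

lemma S_increment:
  assumes "J \<le> l"
  shows "S J x + a * (real l - real J) \<le> S l x" "S l x \<le> S J x + b * (real l - real J)"
  using assms
proof (induction l rule: dec_induct)
  case (step l)
  have "S (Suc l) x = S l x + g l x"
    by (simp add: S_def)
  then show "S J x + a * (real (Suc l) - real J) \<le> S (Suc l) x"
    "S (Suc l) x \<le> S J x + b * (real (Suc l) - real J)"
    using step.IH g_bounds[where l = l and x = x] by (auto simp: algebra_simps)
qed auto

lemma S_bounds: "a * real J \<le> S J x" "S J x \<le> b * real J"
  using S_increment[where J = 0 and l = J and x = x] by (simp_all add: S_def)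

text \<open>Points this close at scale \<open>J\<close> are close enough at every coarser scale, so
  the oscillation bounds of the increments add up.\<close>

lemma S_osc:
  assumes "\<bar>x - t\<bar> \<le> 4 / 2 ^ J"
  shows "\<bar>S J x - S J t\<bar> \<le> E J"
proof -
  have "\<bar>S J x - S J t\<bar> \<le> (\<Sum>l<J. \<bar>g l x - g l t\<bar>)"
    unfolding S_def sum_subtractf[symmetric] by (rule sum_abs)
  also have "\<dots> \<le> E J"
    unfolding E_def
  proof (intro sum_mono g_osc)
    fix l assume "l \<in> {..<J}"
    then have "4 / 2 ^ J \<le> 4 / (2::real) ^ l"
      by (intro divide_left_mono power_increasing) auto
    with assms show "\<bar>x - t\<bar> \<le> 4 / 2 ^ l"
      by linarith
  qed
  finally show ?thesis .
qed

lemma floor_scaled_bounds: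
  fixes x :: real
  shows "of_int \<lfloor>2 ^ l * x\<rfloor> / 2 ^ l \<le> x" "x - 1 / 2 ^ l < of_int \<lfloor>2 ^ l * x\<rfloor> / 2 ^ l"
proof -
  have "of_int \<lfloor>2 ^ l * x\<rfloor> \<le> 2 ^ l * x" "2 ^ l * x < of_int \<lfloor>2 ^ l * x\<rfloor> + 1"
    by linarith+
  then have "of_int \<lfloor>2 ^ l * x\<rfloor> / 2 ^ l \<le> 2 ^ l * x / 2 ^ l"
    "(2 ^ l * x - 1) / 2 ^ l < of_int \<lfloor>2 ^ l * x\<rfloor> / 2 ^ l"
    by (intro divide_right_mono divide_strict_right_mono; simp)+
  then show "of_int \<lfloor>2 ^ l * x\<rfloor> / 2 ^ l \<le> x" "x - 1 / 2 ^ l < of_int \<lfloor>2 ^ l * x\<rfloor> / 2 ^ l"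
    by (simp_all add: diff_divide_distrib)
qed

lemma wave_nonneg: "0 \<le> wave l x"
  by (simp add: wave_def triangle_nonneg)

lemma wave_le:
  assumes "2 powr - S l (of_int \<lfloor>2 ^ l * x\<rfloor> / 2 ^ l) \<le> M"
  shows "wave l x \<le> M" "wave l x \<le> M * \<bar>2 ^ l * x - of_int n\<bar>"
proof -
  have M: "0 \<le> M"
    using powr_ge_zero assms by (rule order.trans)
  show "wave l x \<le> M * \<bar>2 ^ l * x - of_int n\<bar>"
    unfolding wave_def using assms M triangle_le triangle_nonneg by (intro mult_mono) auto
  have "wave l x \<le> M * (1 / 2)"
    unfolding wave_def using assms M triangle_le_half triangle_nonneg by (intro mult_mono) auto
  with M show "wave l x \<le> M"
    by simp
qed

text \<open>Between points of different dyadic intervals lies a zero of the wave.\<close>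

lemma wave_lipschitz:
  assumes "2 powr - S l (of_int \<lfloor>2 ^ l * x\<rfloor> / 2 ^ l) \<le> M"
    and "2 powr - S l (of_int \<lfloor>2 ^ l * y\<rfloor> / 2 ^ l) \<le> M"
  shows "\<bar>wave l x - wave l y\<bar> \<le> M * (2 ^ l * \<bar>x - y\<bar>)"
  using assms
proof (induction x y rule: linorder_wlog)
  case (le x y)
  have M: "0 \<le> M"
    using powr_ge_zero le.prems(1) by (rule order.trans)
  have dist: "2 ^ l * \<bar>x - y\<bar> = 2 ^ l * y - 2 ^ l * x"
    using le.hyps by (simp add: algebra_simps)
  show ?case
  proof (cases "\<lfloor>2 ^ l * x\<rfloor> = \<lfloor>2 ^ l * y\<rfloor>")
    case True
    have "\<bar>wave l x - wave l y\<bar> = 2 powr - S l (of_int \<lfloor>2 ^ l * x\<rfloor> / 2 ^ l) * \<bar>triangle (2 ^ l * x) - triangle (2 ^ l * y)\<bar>"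
      unfolding wave_def True by (simp add: right_diff_distrib[symmetric] abs_mult)
    also have "\<dots> \<le> M * \<bar>2 ^ l * x - 2 ^ l * y\<bar>"
      using le.prems(1) M triangle_nonexpansive by (intro mult_mono) auto
    finally show ?thesis
      using dist le.hyps by (simp add: abs_mult right_diff_distrib[symmetric] abs_minus_commute)
  next
    case False
    \<comment> \<open>The wave vanishes at the scaled position \<open>n\<close>, which lies between
      the two points. Both values are nonnegative and bounded by the distance to \<open>n\<close>,
      so their difference is at most the larger bound.\<close>
    define n where "n = \<lfloor>2 ^ l * y\<rfloor>"
    have "2 ^ l * x \<le> 2 ^ l * y"
      using le.hyps by simp
    then have "\<lfloor>2 ^ l * x\<rfloor> \<le> n"
      unfolding n_def by (rule floor_mono)
    then have "\<lfloor>2 ^ l * x\<rfloor> < n"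
      using False by (simp add: n_def)
    then have n: "2 ^ l * x \<le> of_int n" "of_int n \<le> 2 ^ l * y"
      unfolding n_def by linarith+
    have "wave l x \<le> M * \<bar>2 ^ l * x - of_int n\<bar>" "wave l y \<le> M * \<bar>2 ^ l * y - of_int n\<bar>"
      using wave_le(2) le.prems by blast+
    moreover have "M * \<bar>2 ^ l * x - of_int n\<bar> \<le> M * (2 ^ l * \<bar>x - y\<bar>)"
      "M * \<bar>2 ^ l * y - of_int n\<bar> \<le> M * (2 ^ l * \<bar>x - y\<bar>)"
      unfolding dist using n M by (intro mult_left_mono; simp)+
    ultimately show ?thesis
      using wave_nonneg[of l x] wave_nonneg[of l y] by linarith
  qed
next
  case (sym x y)
  then show ?case
    by (simp add: abs_minus_commute)
qed

section \<open>Upper bounds for the oscillation of the series\<close>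

lemma wave_summable: "summable (\<lambda>l. wave l x)"
proof (rule summable_comparison_test')
  show "summable (\<lambda>l. \<sigma> ^ l)"
    using \<sigma>_bounds by simp
  fix l
  have "\<delta> * real l \<le> a * real l"
    by (intro mult_right_mono) (auto simp: \<delta>_def)
  also have "\<dots> \<le> S l (of_int \<lfloor>2 ^ l * x\<rfloor> / 2 ^ l)"
    by (rule S_bounds)
  finally have "2 powr - S l (of_int \<lfloor>2 ^ l * x\<rfloor> / 2 ^ l) \<le> \<sigma> ^ l"
    unfolding \<sigma>_power by simp
  then show "norm (wave l x) \<le> \<sigma> ^ l"
    using wave_le(1) wave_nonneg by simp
qed

text \<open>For \<open>l < J\<close> the Lipschitz bound gains \<open>2 powr - real (J - l)\<close>,
  while the amplitude can exceed that of level \<open>J\<close> by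
  \<open>2 powr (b * real (J - l))\<close>; since \<open>b + \<delta> \<le> 1\<close>, a factor
  \<open>\<sigma>\<close> per level survives. For \<open>l \<ge> J\<close> the amplitudes alone
  decay that fast. With truncated subtraction the exponent of \<open>\<sigma>\<close> is the
  distance of \<open>l\<close> and \<open>J\<close>.\<close>

lemma wave_diff_le:
  assumes x: "\<bar>x - t\<bar> \<le> 1 / 2 ^ J" and y: "\<bar>y - t\<bar> \<le> 1 / 2 ^ J"
  shows "\<bar>wave l x - wave l y\<bar> \<le> 2 * 2 powr (- S J t + E J) * \<sigma> ^ ((J - l) + (l - J))"
proof (cases "l < J")
  case True
  define M where "M = 2 powr (- S l t + E l)"
  have M: "2 powr - S l (of_int \<lfloor>2 ^ l * z\<rfloor> / 2 ^ l) \<le> M" if "\<bar>z - t\<bar> \<le> 1 / 2 ^ J" for z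
  proof -
    have "1 / 2 ^ J \<le> 1 / (2::real) ^ l"
      using True by (intro divide_left_mono power_increasing) auto
    moreover have "0 < 1 / (2::real) ^ l" "4 / (2::real) ^ l = 4 * (1 / 2 ^ l)"
      by simp_all
    ultimately have "\<bar>of_int \<lfloor>2 ^ l * z\<rfloor> / 2 ^ l - t\<bar> \<le> 4 / 2 ^ l"
      using that floor_scaled_bounds[where l = l and x = z] unfolding abs_le_iff by linarith
    from S_osc[OF this] show ?thesis
      by (simp add: M_def)
  qed
  have pow: "(2::real) ^ l / 2 ^ J = 2 powr - real (J - l)"
    using True by (simp add: of_nat_diff powr_diff powr_realpow)
  have "\<bar>wave l x - wave l y\<bar> \<le> M * (2 ^ l * \<bar>x - y\<bar>)"
    using M x y by (intro wave_lipschitz)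
  also have "\<dots> \<le> M * (2 ^ l * (2 * (1 / 2 ^ J)))"
    using x y by (intro mult_left_mono) (auto simp: M_def)
  also have "\<dots> = 2 * (M * 2 powr - real (J - l))"
    unfolding pow[symmetric] by simp
  also have "M * 2 powr - real (J - l) = 2 powr (- S l t + E l - real (J - l))"
    by (simp add: M_def powr_add[symmetric])
  also have "\<dots> \<le> 2 powr (- S J t + E J - \<delta> * real (J - l))"
  proof -
    have "S J t \<le> S l t + b * real (J - l)"
      using S_increment(2)[of l J t] True by (simp add: of_nat_diff)
    moreover have "(b + \<delta>) * real (J - l) \<le> 1 * real (J - l)"
      by (intro mult_right_mono) (auto simp: \<delta>_def)
    ultimately show ?thesis
      using E_mono[of l J] True by (simp add: algebra_simps)
  qed
  also have "\<dots> = 2 powr (- S J t + E J) * \<sigma> ^ (J - l)"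
    unfolding \<sigma>_power by (simp add: powr_add[symmetric])
  finally show ?thesis
    using True by simp
next
  case False
  have M: "2 powr - S l (of_int \<lfloor>2 ^ l * z\<rfloor> / 2 ^ l) \<le> 2 powr (- S J t + E J - \<delta> * real (l - J))"
    if "\<bar>z - t\<bar> \<le> 1 / 2 ^ J" for z
  proof -
    let ?z = "of_int \<lfloor>2 ^ l * z\<rfloor> / 2 ^ l"
    have "1 / 2 ^ l \<le> 1 / (2::real) ^ J"
      using False by (intro divide_left_mono power_increasing) auto
    moreover have "0 < 1 / (2::real) ^ J" "4 / (2::real) ^ J = 4 * (1 / 2 ^ J)"
      by simp_all
    ultimately have "\<bar>?z - t\<bar> \<le> 4 / 2 ^ J"
      using that floor_scaled_bounds[where l = l and x = z] unfolding abs_le_iff by linarith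
    then have "S J t - E J \<le> S J ?z"
      using S_osc[of ?z t J] by linarith
    moreover have "S J ?z + a * real (l - J) \<le> S l ?z"
      using S_increment(1)[of J l ?z] False by (simp add: of_nat_diff)
    moreover have "\<delta> * real (l - J) \<le> a * real (l - J)"
      by (intro mult_right_mono) (auto simp: \<delta>_def)
    ultimately show ?thesis
      by simp
  qed
  have "\<bar>wave l x - wave l y\<bar> \<le> 2 powr (- S J t + E J - \<delta> * real (l - J))"
    using wave_le(1)[OF M[OF x]] wave_le(1)[OF M[OF y]] wave_nonneg[of l x] wave_nonneg[of l y]
    by linarith
  also have "\<dots> = 2 powr (- S J t + E J) * \<sigma> ^ (l - J)"
    unfolding \<sigma>_power by (simp add: powr_add[symmetric])
  also have "\<dots> \<le> 2 * (2 powr (- S J t + E J) * \<sigma> ^ (l - J))"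
    using \<sigma>_bounds by simp
  finally show ?thesis
    using False by (simp add: mult.assoc)
qed

text \<open>The terms below \<open>J\<close> and those from \<open>J\<close> on are each bounded by
  one full geometric series.\<close>

lemma sums_two_sided_geometric:
  "summable (\<lambda>l. \<sigma> ^ ((J - l) + (l - J)))" "(\<Sum>l. \<sigma> ^ ((J - l) + (l - J))) \<le> 2 / (1 - \<sigma>)"
proof -
  have geo: "summable (\<lambda>l. \<sigma> ^ l)" "(\<Sum>l. \<sigma> ^ l) = 1 / (1 - \<sigma>)"
    using \<sigma>_bounds by (simp_all add: suminf_geometric)
  let ?s = "\<lambda>l. \<sigma> ^ ((J - l) + (l - J))"
  have shift: "(\<lambda>l. ?s (l + J)) = (\<lambda>l. \<sigma> ^ l)"
    by simp
  show summable: "summable ?s"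
    by (subst summable_iff_shift[of ?s J, symmetric]) (simp only: shift geo)
  have "(\<Sum>l<J. ?s l) = (\<Sum>l<J. \<sigma> ^ Suc (J - Suc l))"
    by (intro sum.cong) (auto simp: Suc_diff_Suc simp del: power_Suc)
  also have "\<dots> = (\<Sum>i<J. \<sigma> ^ Suc i)"
    by (rule sum.nat_diff_reindex)
  also have "\<dots> \<le> (\<Sum>i<J. \<sigma> ^ i)"
    using \<sigma>_bounds by (intro sum_mono) (simp add: mult_left_le_one_le)
  also have "\<dots> \<le> (\<Sum>l. \<sigma> ^ l)"
    using \<sigma>_bounds geo(1) by (intro sum_le_suminf) auto
  finally show "(\<Sum>l. ?s l) \<le> 2 / (1 - \<sigma>)"
    using suminf_split_initial_segment[OF summable, of J] geo(2) unfolding shift by simp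
qed

lemma F_osc:
  assumes x: "\<bar>x - t\<bar> \<le> 1 / 2 ^ J" and y: "\<bar>y - t\<bar> \<le> 1 / 2 ^ J"
  shows "\<bar>F x - F y\<bar> \<le> 4 / (1 - \<sigma>) * 2 powr (- S J t + E J)"
proof -
  let ?c = "2 * 2 powr (- S J t + E J)" and ?s = "\<lambda>l. \<sigma> ^ ((J - l) + (l - J))"
  have sum: "summable (\<lambda>l. ?c * ?s l)"
    by (intro summable_mult sums_two_sided_geometric)
  have "F x - F y = (\<Sum>l. wave l x - wave l y)"
    unfolding F_def by (intro suminf_diff wave_summable)
  also have "\<bar>\<dots>\<bar> \<le> (\<Sum>l. ?c * ?s l)"
    using wave_diff_le[OF x y] norm_suminf_le[OF _ sum, of "\<lambda>l. wave l x - wave l y"] by simp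
  also have "\<dots> = ?c * (\<Sum>l. ?s l)"
    by (intro suminf_mult sums_two_sided_geometric)
  also have "\<dots> \<le> ?c * (2 / (1 - \<sigma>))"
    by (intro mult_left_mono sums_two_sided_geometric) simp
  finally show ?thesis
    by simp
qed

text \<open>The integer \<open>n\<close> numbers the half intervals of level \<open>l\<close>: even
  ones rise, odd ones fall. The formula holds up to the right end of a falling half, because the
  triangle is 0 there and hides the jump of the amplitude.\<close>

lemma wave_affine:
  assumes "of_int n \<le> 2 * (2 ^ l * x)" "2 * (2 ^ l * x) \<le> of_int n + 1"
  shows "wave l x = 2 powr - S l (of_int (n div 2) / 2 ^ l) *
    (if even n then 2 ^ l * x - of_int n / 2 else (of_int n + 1) / 2 - 2 ^ l * x)"
proof (cases "even n")
  case True
  then obtain k where k: "n = 2 * k"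
    by blast
  then have *: "of_int k \<le> 2 ^ l * x" "2 ^ l * x \<le> of_int k + 1 / 2"
    using assms by simp_all
  then have "\<lfloor>2 ^ l * x\<rfloor> = k"
    by linarith
  then show ?thesis
    using triangle_even[OF *] by (simp add: wave_def k)
next
  case False
  then obtain k where k: "n = 2 * k + 1"
    by (rule oddE)
  then have *: "of_int (k + 1) - 1 / 2 \<le> 2 ^ l * x" "2 ^ l * x \<le> of_int (k + 1)"
    using assms by simp_all
  have tri: "triangle (2 ^ l * x) = of_int (k + 1) - 2 ^ l * x"
    using triangle_odd[OF *] .
  have div: "n div 2 = k" and half: "(of_int n + 1) / 2 = (of_int (k + 1) :: real)"
    using k by simp_all
  show ?thesis
  proof (cases "2 ^ l * x = of_int (k + 1)")
    case True
    then show ?thesis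
      using tri False half by (simp add: wave_def)
  next
    assume "2 ^ l * x \<noteq> of_int (k + 1)"
    then have "\<lfloor>2 ^ l * x\<rfloor> = k"
      using * by linarith
    then show ?thesis
      using tri False half div by (simp add: wave_def)
  qed
qed

text \<open>For \<open>l < J\<close> the three points lie in one closed half interval of level
  \<open>l\<close>, on which the wave is affine.\<close>

lemma wave_midpoint:
  assumes "l < J"
  shows "2 * wave l (of_int (2 * k + 1) / 2 ^ Suc J)
    = wave l (of_int (2 * k) / 2 ^ Suc J) + wave l (of_int (2 * k + 2) / 2 ^ Suc J)"
proof -
  \<comment> \<open>The number of intervals of length \<open>2 ^ - J\<close> in a half interval of
    level \<open>l\<close>; consequently \<open>k div D\<close> numbers the half interval containing
    the three points.\<close>
  define D :: int where "D = 2 ^ (J - Suc l)"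
  have D: "0 < D"
    by (simp add: D_def)
  have "(2::real) ^ J = 2 ^ Suc l * 2 ^ (J - Suc l)"
    unfolding power_add[symmetric] using assms by simp
  then have pow: "2 * (2 ^ l * (z / 2 ^ Suc J)) = z / (2 * of_int D)" for z :: real
    by (simp add: D_def field_simps)
  define n where "n = k div D"
  have "n * D \<le> k"
    unfolding n_def using div_mult_mod_eq[of k D] pos_mod_sign[OF D, of k] by linarith
  then have n1: "of_int n * of_int D \<le> (of_int k :: real)"
    by (simp flip: of_int_mult)
  have "k mod D < D"
    using D by simp
  then have "k + 1 \<le> (n + 1) * D"
    unfolding n_def distrib_right using div_mult_mod_eq[of k D] by linarith
  then have n2: "(of_int k :: real) + 1 \<le> (of_int n + 1) * of_int D"
    by (metis of_int_1 of_int_add of_int_le_iff of_int_mult)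
  define w where "w = (2::real) ^ l / 2 ^ Suc J"
  have w: "2 ^ l * (of_int i / 2 ^ Suc J) = w * of_int i" for i
    by (simp add: w_def)
  have aff: "wave l (of_int i / 2 ^ Suc J) = 2 powr - S l (of_int (n div 2) / 2 ^ l) *
      (if even n then w * of_int i - of_int n / 2 else (of_int n + 1) / 2 - w * of_int i)"
    if "2 * k \<le> i" "i \<le> 2 * k + 2" for i
    unfolding w[symmetric]
  proof (rule wave_affine)
    have i: "2 * of_int k \<le> (of_int i :: real)" "(of_int i :: real) \<le> 2 * of_int k + 2"
      using that by linarith+
    have "2 * (of_int n * of_int D) \<le> (of_int i :: real)"
      using i n1 by linarith
    then show "of_int n \<le> 2 * (2 ^ l * (of_int i / 2 ^ Suc J) :: real)"
      unfolding pow using D by (simp add: field_simps)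
    have "(of_int i :: real) \<le> 2 * ((of_int n + 1) * of_int D)"
      using i n2 by linarith
    then show "2 * (2 ^ l * (of_int i / 2 ^ Suc J) :: real) \<le> of_int n + 1"
      unfolding pow using D by (simp add: field_simps)
  qed
  have "2 * k \<le> 2 * k" "2 * k \<le> 2 * k + 2" "2 * k \<le> 2 * k + 1" "2 * k + 1 \<le> 2 * k + 2"
    by simp_all
  then show ?thesis
    by (simp only: aff order.refl) (simp add: algebra_simps)
qed

lemma wave_dyadic:
  assumes "L \<le> l"
  shows "wave l (of_int i / 2 ^ L) = 0"
proof -
  have "(2::real) ^ l = 2 ^ L * 2 ^ (l - L)"
    unfolding power_add[symmetric] using assms by simp
  then have "2 ^ l * (of_int i / 2 ^ L) = (of_int (2 ^ (l - L) * i) :: real)"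
    by simp
  then show ?thesis
    unfolding wave_def by (simp only: triangle_of_int mult_zero_right)
qed

lemma F_dyadic: "F (of_int i / 2 ^ L) = (\<Sum>l<L. wave l (of_int i / 2 ^ L))"
  unfolding F_def by (rule suminf_finite) (auto simp: wave_dyadic not_less)

text \<open>The second difference over a dyadic interval kills all coarser terms, being affine
  there, and all finer ones, vanishing at the three points involved.\<close>

lemma F_second_difference:
  "2 * F (of_int (2 * k + 1) / 2 ^ Suc J) - F (of_int (2 * k) / 2 ^ Suc J) - F (of_int (2 * k + 2) / 2 ^ Suc J)
    = 2 powr - S J (of_int k / 2 ^ J)"
proof -
  let ?d = "\<lambda>l. 2 * wave l (of_int (2 * k + 1) / 2 ^ Suc J) - wave l (of_int (2 * k) / 2 ^ Suc J)
    - wave l (of_int (2 * k + 2) / 2 ^ Suc J)"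
  have "2 * F (of_int (2 * k + 1) / 2 ^ Suc J) - F (of_int (2 * k) / 2 ^ Suc J) - F (of_int (2 * k + 2) / 2 ^ Suc J)
    = (\<Sum>l<Suc J. ?d l)"
    unfolding F_dyadic sum_distrib_left sum_subtractf ..
  also have "\<dots> = (\<Sum>l<J. ?d l) + ?d J"
    by simp
  also have "(\<Sum>l<J. ?d l) = 0"
    using wave_midpoint by (intro sum.neutral) auto
  also have "?d J = 2 * wave J (of_int (2 * k + 1) / 2 ^ Suc J)"
  proof -
    have "of_int (2 * k) / 2 ^ Suc J = (of_int k / 2 ^ J :: real)"
      "of_int (2 * k + 2) / 2 ^ Suc J = (of_int (k + 1) / 2 ^ J :: real)"
      by (simp_all add: field_simps)
    then show ?thesis
      using wave_dyadic[of J J k] wave_dyadic[of J J "k + 1"] by simp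
  qed
  \<comment> \<open>The midpoint is the peak of the level \<open>J\<close> wave, where the triangle
    equals 1/2.\<close>
  also have "\<dots> = 2 powr - S J (of_int k / 2 ^ J)"
    using wave_affine[of "2 * k" J "of_int (2 * k + 1) / 2 ^ Suc J"] by (simp add: field_simps)
  finally show ?thesis
    by simp
qed

text \<open>On a dyadic interval of length \<open>2 ^ - J\<close> containing \<open>t\<close>, the
  second difference is a sum of two first differences, so one of them is at least half of it.
  Replacing \<open>t\<close> by the left end of the interval costs at most \<open>E J\<close> in the
  exponent.\<close>

lemma F_osc_lower:
  assumes t: "t \<in> {0..1}"
  obtains x y where "x \<in> {0..1}" "y \<in> {0..1}" "\<bar>x - t\<bar> \<le> 1 / 2 ^ J" "\<bar>y - t\<bar> \<le> 1 / 2 ^ J"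
    "2 powr (- S J t - E J) / 2 \<le> \<bar>F y - F x\<bar>"
proof -
  \<comment> \<open>The cap at \<open>2 ^ J - 1\<close> assigns \<open>t = 1\<close> to the last
    interval inside \<open>[0,1]\<close>.\<close>
  define k where "k = min \<lfloor>2 ^ J * t\<rfloor> (2 ^ J - 1)"
  have "0 \<le> \<lfloor>2 ^ J * t\<rfloor>"
    using t by simp
  then have k0: "0 \<le> k" "k \<le> 2 ^ J - 1"
    by (auto simp: k_def)
  have kt: "of_int k \<le> 2 ^ J * t"
    unfolding k_def by linarith
  have tk: "2 ^ J * t \<le> of_int k + 1"
  proof (cases "k = 2 ^ J - 1")
    case True
    then show ?thesis
      using t by (simp add: mult_left_le)
  next
    case False
    then have "k = \<lfloor>2 ^ J * t\<rfloor>"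
      by (auto simp: k_def)
    then show ?thesis
      by linarith
  qed
  have pt: "of_int i / 2 ^ Suc J \<in> {0..1::real}" "\<bar>of_int i / 2 ^ Suc J - t\<bar> \<le> 1 / 2 ^ J"
    if "2 * k \<le> i" "i \<le> 2 * k + 2" for i
  proof -
    have i: "2 * of_int k \<le> (of_int i :: real)" "(of_int i :: real) \<le> 2 * of_int k + 2"
      using that by linarith+
    have "(of_int k :: real) \<le> of_int (2 ^ J - 1)" "(0::real) \<le> of_int k"
      using k0 by (simp_all only: of_int_le_iff of_int_0_le_iff)
    then show "of_int i / 2 ^ Suc J \<in> {0..1::real}"
      using i by (auto simp: divide_le_eq)
    have "of_int i / 2 ^ Suc J - t = (of_int i - 2 * (2 ^ J * t)) / 2 ^ Suc J"
      by (simp add: field_simps)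
    moreover have "\<bar>of_int i - 2 * (2 ^ J * t)\<bar> / 2 ^ Suc J \<le> 2 / 2 ^ Suc J"
      using i kt tk by (intro divide_right_mono) auto
    ultimately show "\<bar>of_int i / 2 ^ Suc J - t\<bar> \<le> 1 / 2 ^ J"
      by simp
  qed
  let ?p = "of_int (2 * k) / 2 ^ Suc J :: real" and ?m = "of_int (2 * k + 1) / 2 ^ Suc J :: real"
    and ?q = "of_int (2 * k + 2) / 2 ^ Suc J :: real"
  have p: "?p = of_int k / 2 ^ J"
    by simp
  have "1 / 2 ^ J \<le> 4 / (2::real) ^ J"
    by (simp add: divide_right_mono)
  then have "\<bar>?p - t\<bar> \<le> 4 / 2 ^ J"
    using pt(2)[of "2 * k"] by linarith
  from S_osc[OF this] have "- S J t - E J \<le> - S J ?p"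
    by linarith
  then have "2 powr (- S J t - E J) \<le> 2 powr - S J ?p"
    by simp
  also have "\<dots> = (F ?m - F ?p) + (F ?m - F ?q)"
    using F_second_difference[of k J] unfolding p by linarith
  finally have "2 powr (- S J t - E J) / 2 \<le> \<bar>F ?m - F ?p\<bar> \<or> 2 powr (- S J t - E J) / 2 \<le> \<bar>F ?m - F ?q\<bar>"
    by linarith
  moreover have range: "2 * k \<le> 2 * k" "2 * k \<le> 2 * k + 2" "2 * k \<le> 2 * k + 1" "2 * k + 1 \<le> 2 * k + 2"
    by simp_all
  ultimately show thesis
    using that[of ?p ?m] that[of ?q ?m] pt[OF range(1,2)] pt[OF range(3,4)] pt[OF range(2) order.refl]
    by blast
qed

section \<open>Regularity of the series and its local exponents\<close>

lemma E_sublinear: "\<exists>K. \<forall>J. E J \<le> a / 2 * real J + K"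
proof -
  have "\<forall>\<^sub>F J in sequentially. E J / real J < a / 2"
    using e_average a unfolding E_def by (intro order_tendstoD) auto
  then have "\<forall>\<^sub>F J in sequentially. E J \<le> a / 2 * real J"
    using eventually_gt_at_top[of 0] by eventually_elim (simp add: field_simps)
  then obtain k where k: "\<And>J. J \<ge> k \<Longrightarrow> E J \<le> a / 2 * real J"
    by (auto simp: eventually_sequentially)
  \<comment> \<open>The finitely many \<open>J\<close> below \<open>k\<close> are covered by
    \<open>E J \<le> real J\<close>.\<close>
  have "E J \<le> a / 2 * real J + real k" for J
  proof (cases "k \<le> J")
    case True
    then show ?thesis
      using k[of J] by simp
  next
    case False
    then have "E J \<le> real k"
      using E_le[of J] by linarith
    then show ?thesis
      using a by (simp add: add_increasing)
  qed
  then show ?thesis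
    by blast
qed

text \<open>At the dyadic scale of \<open>\<bar>x - y\<bar>\<close> the oscillation bound has
  exponent at least \<open>a * j - E j\<close>. Half of \<open>a\<close> is spent on absorbing
  \<open>E j\<close>, and \<open>a / 2\<close> remains.\<close>

lemma F_hoelder:
  obtains K where "0 < K"
    "\<And>x y. \<lbrakk>x \<in> {0..1}; y \<in> {0..1}\<rbrakk> \<Longrightarrow> \<bar>F x - F y\<bar> \<le> K * \<bar>x - y\<bar> powr (a / 2)"
proof -
  obtain k where k: "\<And>J. E J \<le> a / 2 * real J + k"
    using E_sublinear by blast
  define C where "C = 4 / (1 - \<sigma>)"
  have C: "0 < C"
    using \<sigma>_bounds by (simp add: C_def)
  show thesis
  proof (rule that[of "C * 2 powr k * 2 powr (a / 2)"])
    fix x y :: real assume xy: "x \<in> {0..1}" "y \<in> {0..1}"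
    show "\<bar>F x - F y\<bar> \<le> C * 2 powr k * 2 powr (a / 2) * \<bar>x - y\<bar> powr (a / 2)"
    proof (cases "x = y")
      case False
      then have "0 < \<bar>x - y\<bar>" "\<bar>x - y\<bar> \<le> 2 powr - real 0"
        using xy by auto
      then obtain j where j: "2 powr - real (Suc j) < \<bar>x - y\<bar>" "\<bar>x - y\<bar> \<le> 2 powr - real j"
        using ex_dyadic_scale by blast
      have pow: "2 powr - real j = 1 / (2::real) ^ j"
        by (simp add: powr_minus_divide powr_realpow)
      have "\<bar>F x - F y\<bar> \<le> C * 2 powr (- S j y + E j)"
        unfolding C_def using j(2) pow by (intro F_osc) auto
      also have "\<dots> \<le> C * 2 powr (k + (- real j) * (a / 2))"
        using C k[of j] S_bounds(1)[of j y] by (intro mult_left_mono powr_mono) (auto simp: algebra_simps)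
      also have "\<dots> = C * 2 powr k * (2 powr - real j) powr (a / 2)"
        by (simp only: powr_add powr_powr mult.assoc)
      also have "\<dots> \<le> C * 2 powr k * (2 * \<bar>x - y\<bar>) powr (a / 2)"
      proof (intro mult_left_mono powr_mono2)
        have "2 powr - real j = 2 * (2::real) powr - real (Suc j)"
          by (simp add: powr_minus_divide powr_diff)
        also have "\<dots> \<le> 2 * \<bar>x - y\<bar>"
          using j(1) by (intro mult_left_mono less_imp_le) auto
        finally show "2 powr - real j \<le> 2 * \<bar>x - y\<bar>" .
      qed (use a C in auto)
      also have "\<dots> = C * 2 powr k * 2 powr (a / 2) * \<bar>x - y\<bar> powr (a / 2)"
        by (simp add: powr_mult)
      finally show ?thesis .
    qed simp
  qed (use C in simp)
qed

lemma continuous_on_F: "continuous_on {0..1} F"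
proof -
  obtain K where K: "0 < K"
    "\<And>x y. \<lbrakk>x \<in> {0..1}; y \<in> {0..1}\<rbrakk> \<Longrightarrow> \<bar>F x - F y\<bar> \<le> K * \<bar>x - y\<bar> powr (a / 2)"
    using F_hoelder by blast
  show ?thesis
    unfolding continuous_on_def
  proof
    fix x :: real assume x: "x \<in> {0..1}"
    have "((\<lambda>y. K * \<bar>y - x\<bar> powr (a / 2)) \<longlongrightarrow> K * \<bar>x - x\<bar> powr (a / 2)) (at x within {0..1})"
      using a by (intro tendsto_intros tendsto_powr2) auto
    then have "((\<lambda>y. K * \<bar>y - x\<bar> powr (a / 2)) \<longlongrightarrow> 0) (at x within {0..1})"
      by simp
    moreover have "\<forall>\<^sub>F y in at x within {0..1}. norm (F y - F x) \<le> K * \<bar>y - x\<bar> powr (a / 2)"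
      using K(2) x by (auto simp: eventually_at_filter)
    ultimately have "((\<lambda>y. F y - F x) \<longlongrightarrow> 0) (at x within {0..1})"
      by (rule Lim_null_comparison[rotated])
    then show "(F \<longlongrightarrow> F x) (at x within {0..1})"
      by (simp add: LIM_zero_iff)
  qed
qed

lemma uniformly_hoelder_F: "uniformly_hoelder {0..1} F"
proof -
  obtain K where K: "0 < K"
    "\<And>x y. \<lbrakk>x \<in> {0..1}; y \<in> {0..1}\<rbrakk> \<Longrightarrow> \<bar>F x - F y\<bar> \<le> K * \<bar>x - y\<bar> powr (a / 2)"
    using F_hoelder by blast
  have bound: "Linf_norm (rel_ball {0..1} t r) (\<lambda>x. F x - poly [:F t:] x) \<le> ennreal (K * r powr (a / 2))"
    if t: "t \<in> {0..1}" and "0 < r" for t r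
  proof (rule Linf_norm_le[OF rel_ball_lebesgue])
    show "continuous_on (rel_ball {0..1} t r) (\<lambda>x. F x - poly [:F t:] x)"
      by (intro continuous_on_diff continuous_on_poly continuous_on_id continuous_on_subset[OF continuous_on_F])
        (auto simp: rel_ball_def)
    fix x assume "x \<in> rel_ball {0..1} t r"
    then have x: "x \<in> {0..1}" "\<bar>x - t\<bar> \<le> r"
      by (auto simp: rel_ball_def dist_real_def)
    have "\<bar>F x - F t\<bar> \<le> K * \<bar>x - t\<bar> powr (a / 2)"
      using K(2) x(1) t by blast
    also have "\<dots> \<le> K * r powr (a / 2)"
      using K(1) x(2) a by (intro mult_left_mono powr_mono2) auto
    finally show "\<bar>F x - poly [:F t:] x\<bar> \<le> K * r powr (a / 2)"
      by simp
  qed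
  show ?thesis
    unfolding uniformly_hoelder_def
  proof (intro exI conjI ballI)
    fix t :: real assume "t \<in> {0..1}"
    then show "\<forall>r>0. Linf_norm (rel_ball {0..1} t r) (\<lambda>x. F x - poly [:F t:] x) \<le> ennreal (K * r powr (a / 2))"
      using bound by blast
    show "degree_less [:F t:] (a / 2)"
      using a by (simp add: degree_less_def)
  qed (use a K(1) in auto)
qed

text \<open>The two oscillation bounds enclose the modulus between constant multiples of
  \<open>2 powr (- S J t - E J)\<close> and \<open>2 powr (- S J t + E J)\<close>. Taking logarithms
  and dividing by \<open>J\<close> leaves an error of at most \<open>(E J + K) / J\<close>.\<close>

lemma local_exponent_F:
  assumes t: "t \<in> {0..1}"
  shows "(\<lambda>J. local_exponent 1 F t J - S J t / real J) \<longlonglongrightarrow> 0"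
proof -
  define C where "C = 4 / (1 - \<sigma>)"
  have C: "0 < C"
    using \<sigma>_bounds by (simp add: C_def)
  \<comment> \<open>The upper bound contributes \<open>log 2 C\<close>; the 1 comes from the factor
    1/2 in the lower bound.\<close>
  define K where "K = \<bar>log 2 C\<bar> + 1"
  have "\<forall>\<^sub>F J in sequentially. norm (local_exponent 1 F t J - S J t / real J) \<le> E J / real J + K / real J"
    using eventually_ge_at_top[of 3]
  proof eventually_elim
    case (elim J)
    define p where "p = modulus 1 F t (2 powr - real J)"
    have pow: "2 powr - real J = 1 / (2::real) ^ J"
      by (simp add: powr_minus_divide powr_realpow)
    have up: "p \<le> C * 2 powr (- S J t + E J)"
      unfolding p_def
    proof (rule modulus_le)
      fix x y assume "\<bar>x - t\<bar> \<le> 2 powr - real J" "\<bar>y - t\<bar> \<le> 2 powr - real J"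
      then show "\<bar>chord_diff 1 F x y\<bar> \<le> C * 2 powr (- S J t + E J)"
        unfolding C_def pow using F_osc[of y t J x] by (simp add: chord_diff_1)
    qed (use t in auto)
    obtain x y where xy: "x \<in> {0..1}" "y \<in> {0..1}" "\<bar>x - t\<bar> \<le> 1 / 2 ^ J" "\<bar>y - t\<bar> \<le> 1 / 2 ^ J"
      "2 powr (- S J t - E J) / 2 \<le> \<bar>F y - F x\<bar>"
      using F_osc_lower[OF t] by blast
    have "\<bar>F y - F x\<bar> \<le> p"
      using modulus_ge[OF continuous_on_F, of 1 "2 powr - real J" x t y] xy pow
      by (simp add: p_def chord_diff_1)
    then have "2 powr (- S J t - E J) / 2 \<le> p"
      using xy(5) by linarith
    then have low: "2 powr (- S J t - E J - 1) \<le> p"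
      by (simp add: powr_diff)
    have p: "0 < p"
      by (rule less_le_trans[OF _ low]) simp
    \<comment> \<open>The truncation is inactive from \<open>J = 3\<close> on: the left side is at
      most \<open>2 * J + 1 \<le> 3 * J\<close>.\<close>
    have "S J t + E J + 1 \<le> (real J)\<^sup>2"
    proof -
      have "b * real J \<le> 1 * real J"
        using b by (intro mult_right_mono) auto
      moreover have "3 * real J \<le> (real J)\<^sup>2"
        using elim by (simp add: power2_eq_square)
      ultimately show ?thesis
        using S_bounds(2)[of J t] E_le[of J] elim by linarith
    qed
    then have "2 powr - (real J)\<^sup>2 \<le> 2 powr (- S J t - E J - 1)"
      by simp
    then have "2 powr - (real J)\<^sup>2 \<le> p"
      using low by (rule order.trans)
    then have max_eq: "max p (2 powr - (real J)\<^sup>2) = p"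
      by (rule max_absorb1)
    have le: "local_exponent 1 F t J = - log 2 p / real J"
      unfolding local_exponent_def scale_exponent_def p_def[symmetric] max_eq ..
    have "- S J t - E J - 1 \<le> log 2 p"
      using low p by (subst le_log_iff) auto
    moreover have "log 2 p \<le> log 2 C + (- S J t + E J)"
    proof -
      have "log 2 p \<le> log 2 (C * 2 powr (- S J t + E J))"
        using up p C by (subst log_le_cancel_iff) auto
      also have "\<dots> = log 2 C + (- S J t + E J)"
        using C by (simp add: log_mult)
      finally show ?thesis .
    qed
    ultimately have "\<bar>- log 2 p - S J t\<bar> \<le> E J + K"
      unfolding K_def by linarith
    then have "\<bar>- log 2 p - S J t\<bar> / real J \<le> (E J + K) / real J"
      by (intro divide_right_mono) auto
    moreover have "local_exponent 1 F t J - S J t / real J = (- log 2 p - S J t) / real J"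
      unfolding le by (rule diff_divide_distrib[symmetric])
    ultimately show ?case
      by (simp only: real_norm_def abs_divide abs_of_nat add_divide_distrib)
  qed
  moreover have "(\<lambda>J. E J / real J + K / real J) \<longlonglongrightarrow> 0"
    using tendsto_add[OF e_average lim_const_over_n[of K]] by (simp add: E_def)
  ultimately show ?thesis
    by (rule Lim_null_comparison)
qed

end

subsection \<open>Prescribing both exponents\<close>

text \<open>Bounded difference quotients give decay of order 1 at \<open>t\<close>.
  Contrapositively, a limit inferior below 1 supplies the non-differentiability needed to compute
  the lower exponent.\<close>

lemma differentiable_imp_1_le_liminf:
  assumes t: "t \<in> {0..1}" and d: "f differentiable (at t within {0..1})"
  shows "1 \<le> liminf (\<lambda>j. ereal (local_exponent 1 f t j))"
proof -
  obtain D where "(f has_real_derivative D) (at t within {0..1})"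
    using d by (auto simp: real_differentiable_def)
  then have "((\<lambda>y. (f y - f t) / (y - t)) \<longlongrightarrow> D) (at t within {0..1})"
    by (simp add: has_field_derivative_iff)
  then have "((\<lambda>y. \<bar>(f y - f t) / (y - t)\<bar>) \<longlongrightarrow> \<bar>D\<bar>) (at t within {0..1})"
    by (rule tendsto_rabs)
  then have "\<forall>\<^sub>F y in at t within {0..1}. \<bar>(f y - f t) / (y - t)\<bar> < \<bar>D\<bar> + 1"
    by (rule order_tendstoD) simp
  then obtain R where R: "0 < R"
    "\<And>y. \<lbrakk>y \<in> {0..1}; y \<noteq> t; dist y t < R\<rbrakk> \<Longrightarrow> \<bar>(f y - f t) / (y - t)\<bar> < \<bar>D\<bar> + 1"
    unfolding eventually_at by blast
  have "ereal 1 \<le> liminf (\<lambda>j. ereal (local_exponent 1 f t j))"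
  proof (rule liminf_local_exponent_ge[OF t, of "R / 2" f "f t" "\<bar>D\<bar> + 1"])
    fix r x :: real assume r: "0 < r" "r \<le> R / 2" and x: "x \<in> {0..1}" "\<bar>x - t\<bar> \<le> r"
    have "\<bar>f x - f t\<bar> \<le> (\<bar>D\<bar> + 1) * \<bar>x - t\<bar>"
    proof (cases "x = t")
      case False
      then have "\<bar>(f x - f t) / (x - t)\<bar> < \<bar>D\<bar> + 1"
        using r x by (intro R(2)) (auto simp: dist_real_def)
      with False show ?thesis
        by (simp add: abs_divide pos_divide_less_eq)
    qed simp
    also have "\<dots> \<le> (\<bar>D\<bar> + 1) * r powr 1"
      using r x by (intro mult_left_mono) auto
    finally show "\<bar>f x - f t\<bar> \<le> (\<bar>D\<bar> + 1) * r powr 1" .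
  qed (use R in simp)
  then show ?thesis
    by (simp add: one_ereal_def)
qed

text \<open>Eventually the sequence lies within \<open>\<epsilon>\<close> of \<open>[a,b]\<close>,
  so clamping moves it by less than \<open>\<epsilon>\<close>. Bounds that hold only in the limit
  can thus be imposed at every index without changing the limits.\<close>

lemma clamp_difference_tendsto_0:
  fixes X :: "nat \<Rightarrow> real"
  assumes low: "ereal a \<le> liminf (\<lambda>j. ereal (X j))" and up: "limsup (\<lambda>j. ereal (X j)) \<le> ereal b"
    and "a \<le> b"
  shows "(\<lambda>j. max a (min b (X j)) - X j) \<longlonglongrightarrow> 0"
proof (rule tendstoI)
  fix \<epsilon> :: real assume "0 < \<epsilon>"
  then have "ereal (a - \<epsilon>) < ereal a" "ereal b < ereal (b + \<epsilon>)"
    by simp_all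
  then have "ereal (a - \<epsilon>) < liminf (\<lambda>j. ereal (X j))" "limsup (\<lambda>j. ereal (X j)) < ereal (b + \<epsilon>)"
    using less_le_trans[OF _ low] le_less_trans[OF up] by blast+
  from less_LiminfD[OF this(1)] Limsup_lessD[OF this(2)]
  show "\<forall>\<^sub>F j in sequentially. dist (max a (min b (X j)) - X j) 0 < \<epsilon>"
    by eventually_elim (use \<open>0 < \<epsilon>\<close> \<open>a \<le> b\<close> in \<open>auto simp: dist_real_def max_def min_def\<close>)
qed

lemma dyadic_modulus_of_continuity:
  fixes H :: "real \<Rightarrow> real"
  assumes "continuous_on {0..1} H" "0 < \<epsilon>"
  shows "\<exists>m::nat. \<forall>x\<in>{0..1}. \<forall>y\<in>{0..1}. \<bar>x - y\<bar> \<le> 4 / 2 ^ m \<longrightarrow> \<bar>H x - H y\<bar> \<le> \<epsilon>"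
proof -
  have "uniformly_continuous_on {0..1} H"
    using assms(1) by (rule compact_uniformly_continuous) simp
  then obtain d where d: "0 < d"
    "\<And>x y. \<lbrakk>x \<in> {0..1}; y \<in> {0..1}; dist y x < d\<rbrakk> \<Longrightarrow> dist (H y) (H x) < \<epsilon>"
    using assms(2) unfolding uniformly_continuous_on_def by metis
  obtain m where m: "(1 / 2) ^ m < d / 4"
    using real_arch_pow_inv[of "d / 4" "1 / 2"] d(1) by auto
  then have "4 / 2 ^ m < d"
    by (simp add: power_one_over field_simps)
  then show ?thesis
    using d(2) by (intro exI[of _ m]) (force simp: dist_real_def abs_minus_commute)
qed

theorem prescribed_exponents:
  fixes H :: "nat \<Rightarrow> real \<Rightarrow> real"
  assumes ab: "a \<le> b" "0 < a" "b < 1"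
    and H: "\<And>j. continuous_on {0..1} (H j)"
    and low: "\<And>t. t \<in> {0..1} \<Longrightarrow> ereal a \<le> liminf (\<lambda>j. ereal (H j t))"
    and up: "\<And>t. t \<in> {0..1} \<Longrightarrow> limsup (\<lambda>j. ereal (H j t)) \<le> ereal b"
  obtains f :: "real \<Rightarrow> real" where "continuous_on {0..1} f" "uniformly_hoelder {0..1} f"
    "\<And>t. t \<in> {0..1} \<Longrightarrow> lower_hoelder_exponent {0..1} f t = liminf (\<lambda>j. ereal (H j t))"
    "\<And>t. t \<in> {0..1} \<Longrightarrow> upper_hoelder_exponent {0..1} f t = limsup (\<lambda>j. ereal (H j t))"
proof -
  define h where "h i x = max a (min b (H i (clamp01 x)))" for i x
  have h_bounds: "a \<le> h i x" "h i x \<le> b" for i x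
    using ab by (auto simp: h_def)
  have "\<exists>m::nat. \<forall>x\<in>{0..1}. \<forall>y\<in>{0..1}. \<bar>x - y\<bar> \<le> 4 / 2 ^ m \<longrightarrow> \<bar>H i x - H i y\<bar> \<le> 1 / (real i + 1)" for i
    by (intro dyadic_modulus_of_continuity H) simp
  then obtain m :: "nat \<Rightarrow> nat" where m: "\<And>i x y. \<lbrakk>x \<in> {0..1}; y \<in> {0..1}; \<bar>x - y\<bar> \<le> 4 / 2 ^ m i\<rbrakk>
      \<Longrightarrow> \<bar>H i x - H i y\<bar> \<le> 1 / (real i + 1)"
    by metis
  \<comment> \<open>Block 0 has to begin at level 0. Its oscillation bound is 1, which is trivial
    for values in \<open>[a,b]\<close>.\<close>
  define M where "M = m(0 := 0)"
  define e where "e l = 1 / (real (block_index M l) + 1)" for l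
  define g where "g l = h (block_index M l)" for l
  have osc: "\<bar>g l x - g l y\<bar> \<le> e l" if xy: "\<bar>x - y\<bar> \<le> 4 / 2 ^ l" for l x y
  proof (cases "block_index M l = 0")
    case True
    then show ?thesis
      using h_bounds[of 0 x] h_bounds[of 0 y] ab by (simp add: g_def e_def abs_le_iff)
  next
    case False
    define i where "i = block_index M l"
    have "m i \<le> l"
      using block_index_delay[of M l] False by (simp add: M_def i_def)
    then have "4 / 2 ^ l \<le> 4 / (2::real) ^ m i"
      by (intro divide_left_mono power_increasing) auto
    then have "\<bar>clamp01 x - clamp01 y\<bar> \<le> 4 / 2 ^ m i"
      using xy clamp01_nonexpansive[of x y] by linarith
    then have "\<bar>H i (clamp01 x) - H i (clamp01 y)\<bar> \<le> e l"
      unfolding e_def i_def[symmetric] by (intro m clamp01_mem)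
    moreover have "\<bar>g l x - g l y\<bar> \<le> \<bar>H i (clamp01 x) - H i (clamp01 y)\<bar>"
      by (auto simp: g_def h_def i_def max_def min_def)
    ultimately show ?thesis
      by linarith
  qed
  \<comment> \<open>The oscillation bounds tend to 0 along the blocks. As they are nonnegative, a
    limit superior of their averages of at most 0 already means convergence to 0.\<close>
  have "(\<lambda>i. 1 / (real i + 1)) \<longlonglongrightarrow> 0"
    using LIMSEQ_inverse_real_of_nat by (simp add: inverse_eq_divide add.commute)
  then have "e \<longlonglongrightarrow> 0"
    unfolding e_def by (rule filterlim_compose) (rule filterlim_block_index)
  then have "limsup (\<lambda>l. ereal (e l)) = 0"
    by (intro lim_imp_Limsup) (simp_all add: zero_ereal_def)
  then have average: "limsup (\<lambda>J. ereal ((\<Sum>l<J. e l) / real J)) \<le> 0"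
    using limsup_average_le[of e] by simp
  have e_average: "(\<lambda>J. (\<Sum>l<J. e l) / real J) \<longlonglongrightarrow> 0"
  proof (rule tendstoI)
    fix \<epsilon> :: real assume "0 < \<epsilon>"
    then have "limsup (\<lambda>J. ereal ((\<Sum>l<J. e l) / real J)) < ereal \<epsilon>"
      using average by (simp add: le_less_trans)
    from Limsup_lessD[OF this] have "\<forall>\<^sub>F J in sequentially. (\<Sum>l<J. e l) / real J < \<epsilon>"
      by simp
    moreover have "0 \<le> (\<Sum>l<J. e l) / real J" for J
      by (simp add: e_def sum_nonneg)
    ultimately show "\<forall>\<^sub>F J in sequentially. dist ((\<Sum>l<J. e l) / real J) 0 < \<epsilon>"
      by (simp add: dist_real_def del: abs_divide)
  qed
  interpret slow_exponents g a b e
  proof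
    show "0 \<le> e l" "e l \<le> 1" for l
      by (simp_all add: e_def)
    show "a \<le> g l x" "g l x \<le> b" for l x
      by (simp_all add: g_def h_bounds)
  qed (use ab osc e_average in auto)
  have exps: "liminf (\<lambda>j. ereal (local_exponent 1 F t j)) = liminf (\<lambda>j. ereal (H j t))"
    "limsup (\<lambda>j. ereal (local_exponent 1 F t j)) = limsup (\<lambda>j. ereal (H j t))" if t: "t \<in> {0..1}" for t
  proof -
    have S: "S J t = (\<Sum>l<J. h (block_index M l) t)" for J
      by (simp add: S_def g_def)
    have h1: "\<bar>h i t\<bar> \<le> 1" for i
      using h_bounds[of i t] ab by (simp add: abs_le_iff)
    have "(\<lambda>j. h j t - H j t) \<longlonglongrightarrow> 0"
      using clamp_difference_tendsto_0[OF low[OF t] up[OF t] ab(1)] t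
      by (simp add: h_def clamp01_id)
    note hH = limsup_liminf_cong[OF this]
    note local = limsup_liminf_cong[OF local_exponent_F[OF t]]
    show "liminf (\<lambda>j. ereal (local_exponent 1 F t j)) = liminf (\<lambda>j. ereal (H j t))"
      unfolding local S liminf_block_average[of "\<lambda>i. h i t", OF h1] hH ..
    show "limsup (\<lambda>j. ereal (local_exponent 1 F t j)) = limsup (\<lambda>j. ereal (H j t))"
      unfolding local S limsup_block_average[of "\<lambda>i. h i t", OF h1] hH ..
  qed
  show thesis
  proof (rule that[OF continuous_on_F uniformly_hoelder_F])
    fix t :: real assume t: "t \<in> {0..1}"
    have le: "liminf (\<lambda>j. ereal (H j t)) \<le> limsup (\<lambda>j. ereal (H j t))"
      by (rule Liminf_le_Limsup) simp
    have "ereal b < 1" "0 < ereal a"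
      using ab by (simp_all add: one_ereal_def zero_ereal_def)
    then have less1: "limsup (\<lambda>j. ereal (H j t)) < 1" and pos: "0 < liminf (\<lambda>j. ereal (H j t))"
      using le_less_trans[OF up[OF t]] less_le_trans[OF _ low[OF t]] by blast+
    \<comment> \<open>Both limits of the local exponents of \<open>F\<close> are those of
      \<open>H\<close> and lie below 1, whereas differentiability would push the limit inferior up
      to 1.\<close>
    have "\<not> F differentiable (at t within {0..1})"
    proof
      assume "F differentiable (at t within {0..1})"
      from differentiable_imp_1_le_liminf[OF t this]
      have "1 \<le> limsup (\<lambda>j. ereal (H j t))"
        unfolding exps[OF t] using le by (rule order.trans)
      with less1 show False
        by simp
    qed
    then show "lower_hoelder_exponent {0..1} F t = liminf (\<lambda>j. ereal (H j t))"
      using lower_hoelder_exponent_eq_liminf[OF continuous_on_F t] exps[OF t] by simp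
    have "0 \<le> limsup (\<lambda>j. ereal (local_exponent 1 F t j))"
      unfolding exps[OF t] using order.trans[OF less_imp_le[OF pos] le] .
    moreover have "limsup (\<lambda>j. ereal (local_exponent 1 F t j)) < 1"
      unfolding exps[OF t] by (rule less1)
    ultimately show "upper_hoelder_exponent {0..1} F t = limsup (\<lambda>j. ereal (H j t))"
      using upper_hoelder_exponent_eq_limsup[OF continuous_on_F t] exps[OF t] by simp
  qed
qed

lemma continuous_imp_locally_bounded:
  assumes "continuous_on {0..1} f"
  shows "locally_bounded {0..1} f"
  unfolding locally_bounded_def
proof
  fix x :: real
  have "bounded (f ` {0..1})"
    using assms by (intro compact_imp_bounded compact_continuous_image) auto
  then have "bounded (f ` rel_ball {0..1} x 1)"
    by (rule bounded_subset) (auto simp: rel_ball_def)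
  then show "\<exists>r>0. bounded (f ` rel_ball {0..1} x r)"
    by (intro exI[of _ 1]) simp
qed

theorem theorem4:
  shows "(\<forall>f :: real \<Rightarrow> real.
            continuous_on {0..1} f \<and>
            (\<forall>t\<in>{0..1}. \<not> f differentiable (at t within {0..1})) \<longrightarrow>
            (\<exists>H :: nat \<Rightarrow> real \<Rightarrow> real.
               (\<forall>j. continuous_on {0..1} (H j)) \<and>
               (\<forall>t\<in>{0..1}.
                  lower_hoelder_exponent {0..1} f t = liminf (\<lambda>j. ereal (H j t)) \<and>
                  upper_hoelder_exponent {0..1} f t = limsup (\<lambda>j. ereal (H j t)))))
       \<and>
         (\<forall>(a :: real) (b :: real) (Hlow :: real \<Rightarrow> real) (Hup :: real \<Rightarrow> real)
            (H :: nat \<Rightarrow> real \<Rightarrow> real).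
            a \<le> b \<and> {a..b} \<subseteq> {0<..<1} \<and>
            Hlow \<in> {0..1} \<rightarrow> {a..b} \<and> Hup \<in> {0..1} \<rightarrow> {a..b} \<and>
            (\<forall>j. continuous_on {0..1} (H j)) \<and>
            (\<forall>t\<in>{0..1}.
               ereal (Hlow t) = liminf (\<lambda>j. ereal (H j t)) \<and>
               ereal (Hup t) = limsup (\<lambda>j. ereal (H j t))) \<longrightarrow>
            (\<exists>f :: real \<Rightarrow> real.
               locally_bounded {0..1} f \<and> uniformly_hoelder {0..1} f \<and>
               (\<forall>t\<in>{0..1}.
                  lower_hoelder_exponent {0..1} f t = ereal (Hlow t) \<and>
                  Hlow t \<le> Hup t \<and>
                  ereal (Hup t) = upper_hoelder_exponent {0..1} f t)))"
proof (intro conjI allI impI)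
  fix f :: "real \<Rightarrow> real"
  assume "continuous_on {0..1} f \<and> (\<forall>t\<in>{0..1}. \<not> f differentiable (at t within {0..1}))"
  then show "\<exists>H :: nat \<Rightarrow> real \<Rightarrow> real. (\<forall>j. continuous_on {0..1} (H j)) \<and>
    (\<forall>t\<in>{0..1}. lower_hoelder_exponent {0..1} f t = liminf (\<lambda>j. ereal (H j t)) \<and>
                upper_hoelder_exponent {0..1} f t = limsup (\<lambda>j. ereal (H j t)))"
    by (intro exponents_of_nowhere_differentiable) auto
next
  fix a b :: real and Hlow Hup :: "real \<Rightarrow> real" and H :: "nat \<Rightarrow> real \<Rightarrow> real"
  assume asm: "a \<le> b \<and> {a..b} \<subseteq> {0<..<1} \<and>
    Hlow \<in> {0..1} \<rightarrow> {a..b} \<and> Hup \<in> {0..1} \<rightarrow> {a..b} \<and>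
    (\<forall>j. continuous_on {0..1} (H j)) \<and>
    (\<forall>t\<in>{0..1}. ereal (Hlow t) = liminf (\<lambda>j. ereal (H j t)) \<and>
                ereal (Hup t) = limsup (\<lambda>j. ereal (H j t)))"
  then have ab: "a \<le> b" "0 < a" "b < 1" and H: "\<And>j. continuous_on {0..1} (H j)"
    by auto
  have eq: "liminf (\<lambda>j. ereal (H j t)) = ereal (Hlow t)" "limsup (\<lambda>j. ereal (H j t)) = ereal (Hup t)"
    and bounds: "a \<le> Hlow t" "Hup t \<le> b" if "t \<in> {0..1}" for t
    using asm that by (auto simp: Pi_iff)
  have le: "Hlow t \<le> Hup t" if "t \<in> {0..1}" for t
    using Liminf_le_Limsup[of sequentially "\<lambda>j. ereal (H j t)"] eq[OF that] by simp
  show "\<exists>f :: real \<Rightarrow> real. locally_bounded {0..1} f \<and> uniformly_hoelder {0..1} f \<and>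
    (\<forall>t\<in>{0..1}. lower_hoelder_exponent {0..1} f t = ereal (Hlow t) \<and> Hlow t \<le> Hup t \<and>
                ereal (Hup t) = upper_hoelder_exponent {0..1} f t)"
  proof (rule prescribed_exponents[of a b H, OF ab H])
    fix f :: "real \<Rightarrow> real"
    assume "continuous_on {0..1} f" "uniformly_hoelder {0..1} f"
      "\<And>t. t \<in> {0..1} \<Longrightarrow> lower_hoelder_exponent {0..1} f t = liminf (\<lambda>j. ereal (H j t))"
      "\<And>t. t \<in> {0..1} \<Longrightarrow> upper_hoelder_exponent {0..1} f t = limsup (\<lambda>j. ereal (H j t))"
    then show ?thesis
      using eq le by (intro exI[of _ f] conjI continuous_imp_locally_bounded) simp_all
  qed (use eq bounds in simp_all)
qed

end
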